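(* Let $Q\subseteq\mathbb R^n$ be a closed convex set of diameter $2\tilde R$. Let $f:Q\to\mathbb R$ be a tilted-convex function with constants $\gamma_n,\gamma_p\in(0,1]$, and with $\tilde L$-Lipschitz gradients. Let $f$ be $\tilde L(\tilde R_g+2\tilde R)$-Lipschitz, where $\tilde R_g\geq 0$. Then one can obtain an $\varepsilon$-minimizer of $f$ in $Q$ by using $$\widetilde O\left(\sqrt{\frac{\tilde L\tilde R^2}{\gamma_n^2\gamma_p\,\varepsilon}}\right)$$ queries to the gradient oracle of $f$.
   Context: A differentiable function $f:Q\to\mathbb R$ is tilted-convex with constants $\gamma_n,\gamma_p\in(0,1]$ if for all $\tilde x,\tilde y\in Q$: $$f(\tilde x)+\tfrac1{\gamma_n}\langle\nabla f(\tilde x),\tilde y-\tilde x\rangle\le f(\tilde y)\quad\text{if }\langle\nabla f(\tilde x),\tilde y-\tilde x\rangle\le0,$$ $$f(\tilde x)+\gamma_p\langle\nabla f(\tilde x),\tilde y-\tilde x\rangle\le f(\tilde y)\quad\text{if }\langle\nabla f(\tilde x),\tilde y-\tilde x\rangle\ge0.$$ An $\varepsilon$-minimizer of $f$ in $Q$ is a point $\hat x\in Q$ with $f(\hat x)-\min_{Q}f\le\varepsilon$. The algorithm knows $\tilde L,\gamma_n,\gamma_p,\tilde R,\tilde R_g,\varepsilon$, may compute Euclidean projections onto $Q$, and a gradient oracle query returns first-order information (value and gradient) of $f$ at a queried point of $Q$. $\widetilde O(\cdot)$ omits factors logarithmic in the problem parameters $\tilde L,\tilde R,\tilde R_g,1/\gamma_n,1/\gamma_p,1/\varepsilon$;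 the remaining hidden constant is absolute. *)

theory Defs
  imports "HOL-Analysis.Analysis"
begin

text \<open>
  The hidden constant of the complexity bound has to be independent of the dimension \<open>n\<close>, so \<open>n\<close>
  must be quantified inside the statement and cannot be the index type of \<open>real ^ 'n\<close>. All
  spaces \<open>\<real>\<^sup>n\<close> are therefore realised inside a single inner product space, the space of
  finitely supported real sequences with \<open>x \<bullet> y = (\<Sum>i. x\<^sub>i y\<^sub>i)\<close>; \<open>\<real>\<^sup>n\<close> is the subspace of
  sequences vanishing from index \<open>n\<close> on.
\<close>

typedef fin_vec = "{x :: nat \<Rightarrow> real. finite {i. x i \<noteq> 0}}"
  morphisms coord Fin_vec
  by (rule exI[of _ "\<lambda>_. 0"]) simp

setup_lifting type_definition_fin_vec

lemma finite_support: "finite {i. coord x i \<noteq> 0}"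
  using coord[of x] by simp

instantiation fin_vec :: real_inner
begin

lift_definition zero_fin_vec :: fin_vec is "\<lambda>_. 0" by simp

lift_definition plus_fin_vec :: "fin_vec \<Rightarrow> fin_vec \<Rightarrow> fin_vec" is "\<lambda>x y i. x i + y i"
proof -
  fix x y :: "nat \<Rightarrow> real"
  assume "finite {i. x i \<noteq> 0}" "finite {i. y i \<noteq> 0}"
  then show "finite {i. x i + y i \<noteq> 0}"
    by (rule rev_finite_subset[OF finite_UnI]) auto
qed

lift_definition uminus_fin_vec :: "fin_vec \<Rightarrow> fin_vec" is "\<lambda>x i. - x i" by simp

lift_definition minus_fin_vec :: "fin_vec \<Rightarrow> fin_vec \<Rightarrow> fin_vec" is "\<lambda>x y i. x i - y i"
proof -
  fix x y :: "nat \<Rightarrow> real"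
  assume "finite {i. x i \<noteq> 0}" "finite {i. y i \<noteq> 0}"
  then show "finite {i. x i - y i \<noteq> 0}"
    by (rule rev_finite_subset[OF finite_UnI]) auto
qed

lift_definition scaleR_fin_vec :: "real \<Rightarrow> fin_vec \<Rightarrow> fin_vec" is "\<lambda>c x i. c * x i"
  by (rule rev_finite_subset) auto

definition inner_fin_vec :: "fin_vec \<Rightarrow> fin_vec \<Rightarrow> real"
  where "inner_fin_vec x y = (\<Sum>i\<in>{i. coord x i \<noteq> 0}. coord x i * coord y i)"

definition norm_fin_vec :: "fin_vec \<Rightarrow> real"
  where "norm_fin_vec x = sqrt (inner x x)"

definition dist_fin_vec :: "fin_vec \<Rightarrow> fin_vec \<Rightarrow> real"
  where "dist_fin_vec x y = norm (x - y)"

definition sgn_fin_vec :: "fin_vec \<Rightarrow> fin_vec"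
  where "sgn_fin_vec x = inverse (norm x) *\<^sub>R x"

definition uniformity_fin_vec :: "(fin_vec \<times> fin_vec) filter"
  where "uniformity_fin_vec = (INF e\<in>{0<..}. principal {(x, y). dist x y < e})"

definition open_fin_vec :: "fin_vec set \<Rightarrow> bool"
  where "open_fin_vec U =
    (\<forall>x\<in>U. eventually (\<lambda>(x', y). x' = x \<longrightarrow> y \<in> U) uniformity)"

lemma inner_fin_vec_eq_sum:
  assumes "finite S" "{i. coord x i \<noteq> 0} \<subseteq> S"
  shows "x \<bullet> y = (\<Sum>i\<in>S. coord x i * coord y i)"
  unfolding inner_fin_vec_def by (rule sum.mono_neutral_left) (use assms in auto)

instance
proof
  fix x y z :: fin_vec and a b :: real
  show "x + y + z = x + (y + z)" by transfer auto
  show "x + y = y + x" by transfer auto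
  show "0 + x = x" by transfer auto
  show "- x + x = 0" by transfer auto
  show "x - y = x + - y" by transfer auto
  show "a *\<^sub>R (x + y) = a *\<^sub>R x + a *\<^sub>R y" by transfer (auto simp: algebra_simps)
  show "(a + b) *\<^sub>R x = a *\<^sub>R x + b *\<^sub>R x" by transfer (auto simp: algebra_simps)
  show "a *\<^sub>R b *\<^sub>R x = (a * b) *\<^sub>R x" by transfer auto
  show "1 *\<^sub>R x = x" by transfer auto
  show "dist x y = norm (x - y)" by (rule dist_fin_vec_def)
  show "sgn x = inverse (norm x) *\<^sub>R x" by (rule sgn_fin_vec_def)
  show "uniformity = (INF e\<in>{0<..}. principal {(x :: fin_vec, y). dist x y < e})"
    by (rule uniformity_fin_vec_def)
  show "open U = (\<forall>x\<in>U. eventually (\<lambda>(x', y). x' = x \<longrightarrow> y \<in> U) uniformity)"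
    for U :: "fin_vec set"
    by (rule open_fin_vec_def)
  show "norm x = sqrt (x \<bullet> x)" by (rule norm_fin_vec_def)
  define S where
    "S = {i. coord x i \<noteq> 0} \<union> {i. coord y i \<noteq> 0} \<union> {i. coord z i \<noteq> 0}"
  have S: "finite S" by (simp add: S_def finite_support)
  have eq: "u \<bullet> v = (\<Sum>i\<in>S. coord u i * coord v i)"
    if "u \<in> {x, y, x + y, a *\<^sub>R x}" for u v
    by (rule inner_fin_vec_eq_sum[OF S])
      (use that in \<open>auto simp: S_def plus_fin_vec.rep_eq scaleR_fin_vec.rep_eq\<close>)
  show "x \<bullet> y = y \<bullet> x" by (simp add: eq mult.commute)
  show "(x + y) \<bullet> z = x \<bullet> z + y \<bullet> z"
    by (simp add: eq plus_fin_vec.rep_eq sum.distrib algebra_simps)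
  show "(a *\<^sub>R x) \<bullet> y = a * (x \<bullet> y)"
    by (simp add: eq scaleR_fin_vec.rep_eq sum_distrib_left algebra_simps)
  show "0 \<le> x \<bullet> x" by (simp add: eq sum_nonneg)
  have "x \<bullet> x = 0 \<longleftrightarrow> (\<forall>i. coord x i = 0)"
    unfolding inner_fin_vec_def by (subst sum_nonneg_eq_0_iff) (auto simp: finite_support)
  then show "x \<bullet> x = 0 \<longleftrightarrow> x = 0"
    by (auto simp: coord_inject[symmetric] zero_fin_vec.rep_eq fun_eq_iff)
qed

end

definition Rn :: "nat \<Rightarrow> fin_vec set"
  where "Rn n = {x. \<forall>i\<ge>n. coord x i = 0}"

lemma inner_Rn: "x \<in> Rn n \<Longrightarrow> x \<bullet> y = (\<Sum>i<n. coord x i * coord y i)"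
  by (rule inner_fin_vec_eq_sum) (auto simp: Rn_def not_le[symmetric])

text \<open>
  \<open>f\<close> is differentiable on \<open>Q\<close> with gradient field \<open>g\<close>. Since \<open>f\<close> lives on \<open>Q\<close> only, the derivative
  is taken within \<open>Q\<close>. If \<open>Q\<close> has empty interior, \<open>g\<close> is any field representing it.
\<close>

definition gradient_on :: "'a::real_inner set \<Rightarrow> ('a \<Rightarrow> real) \<Rightarrow> ('a \<Rightarrow> 'a) \<Rightarrow> bool"
  where "gradient_on Q f g \<longleftrightarrow>
    (\<forall>x\<in>Q. (f has_derivative (\<lambda>h. g x \<bullet> h)) (at x within Q))"

definition tilted_convex_on ::
    "'a::real_inner set \<Rightarrow> ('a \<Rightarrow> real) \<Rightarrow> ('a \<Rightarrow> 'a) \<Rightarrow> real \<Rightarrow> real \<Rightarrow> bool"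
  where "tilted_convex_on Q f g \<gamma>\<^sub>n \<gamma>\<^sub>p \<longleftrightarrow>
    gradient_on Q f g \<and> \<gamma>\<^sub>n \<in> {0<..1} \<and> \<gamma>\<^sub>p \<in> {0<..1} \<and>
    (\<forall>x\<in>Q. \<forall>y\<in>Q.
      (g x \<bullet> (y - x) \<le> 0 \<longrightarrow> f x + 1 / \<gamma>\<^sub>n * (g x \<bullet> (y - x)) \<le> f y) \<and>
      (g x \<bullet> (y - x) \<ge> 0 \<longrightarrow> f x + \<gamma>\<^sub>p * (g x \<bullet> (y - x)) \<le> f y))"

definition eps_minimizer :: "'a set \<Rightarrow> ('a \<Rightarrow> real) \<Rightarrow> real \<Rightarrow> 'a \<Rightarrow> bool"
  where "eps_minimizer Q f \<epsilon> x \<longleftrightarrow>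
    x \<in> Q \<and> (\<exists>m. is_arg_min f (\<lambda>y. y \<in> Q) m \<and> f x - f m \<le> \<epsilon>)"

text \<open>
  A deterministic adaptive algorithm is an interaction tree. The feasible set and the objective
  are not visible to it except through the answers to its projection calls and its gradient
  oracle queries; every branch of the tree is finite.
\<close>

datatype 'a algorithm =
    Output 'a
  | Project 'a "'a \<Rightarrow> 'a algorithm"
  | Query 'a "real \<Rightarrow> 'a \<Rightarrow> 'a algorithm"

text \<open>
  \<open>runs Q f g A x N\<close>: on the instance \<open>(Q, f, g)\<close> the algorithm \<open>A\<close> outputs \<open>x\<close> after exactly \<open>N\<close>
  gradient oracle queries. Projections are not counted. A query outside \<open>Q\<close> is not answered, so
  no run exists in that case.
\<close>

inductive runs ::
    "'a::metric_space set \<Rightarrow> ('a \<Rightarrow> real) \<Rightarrow> ('a \<Rightarrow> 'a) \<Rightarrow> 'a algorithm \<Rightarrow> 'a \<Rightarrow> nat \<Rightarrow> bool"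
  for Q f g where
  run_output: "runs Q f g (Output x) x 0"
| run_project: "runs Q f g (k (arg_min_on (dist x) Q)) y N \<Longrightarrow> runs Q f g (Project x k) y N"
| run_query: "x \<in> Q \<Longrightarrow> runs Q f g (k (f x) (g x)) y N \<Longrightarrow> runs Q f g (Query x k) y (Suc N)"

end

theory Submission
  imports Defs
begin

text \<open>
  The method is an extragradient discretisation of accelerated mirror descent. With weights \<open>A\<close> of
  order \<open>\<gamma>\<^sub>n\<^sup>2 \<gamma>\<^sub>p j\<^sup>2 / L\<close> and a minimizer \<open>m\<close>, a step sends \<open>(y, z)\<close> to \<open>(x, p)\<close> such that the
  potential \<open>A (f y - f m) + \<parallel>z - m\<parallel>\<^sup>2 / 2\<close> grows only by a small error. Here \<open>x\<close> lies on the segment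
  from \<open>y\<close> to the extragradient predictor, at a position \<open>\<tau>\<close> for which \<open>f x - f y \<le> c (g x \<bullet> (x - y))\<close>
  up to this error, where \<open>c = \<eta> (1 - \<tau>) / (\<tau> A)\<close> has to lie in \<open>[\<gamma>\<^sub>p, 1 / \<gamma>\<^sub>n]\<close>. Tilted
  convexity makes this true at one of the ends of this range or where \<open>g x \<bullet> (x - y)\<close> changes
  sign; the sign change is located by bisection, at the cost of a logarithmic factor. The lower
  bound \<open>c \<ge> \<gamma>\<^sub>p\<close> bounds \<open>\<tau>\<close>, which is what allows the step size \<open>\<eta>\<close>.
\<close>

section \<open>Compactness and projections\<close>

text \<open>The ambient space is infinite-dimensional, so compactness has to come from the vanishing
  of the coordinates from \<open>n\<close> on. By induction on \<open>n\<close>, each further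
  coordinate makes the box a continuous image of a product with an interval.\<close>

lemma compact_Rn_box: "compact {x \<in> Rn n. \<forall>i. \<bar>coord x i\<bar> \<le> M}"
proof (cases "M < 0")
  case True
  then have "{x \<in> Rn n. \<forall>i. \<bar>coord x i\<bar> \<le> M} = {}"
    by (auto intro!: exI[of _ "0::nat"])
  then show ?thesis by (metis compact_empty)
next
  \<comment> \<open>\<open>0 \<le> M\<close> lets the inductive step replace the last coordinate by
    0 without leaving the box.\<close>
  case M: False
  show ?thesis
  proof (induction n)
    case 0
    have "{x \<in> Rn 0. \<forall>i. \<bar>coord x i\<bar> \<le> M} \<subseteq> {0}"
      by (auto simp: Rn_def coord_inject[symmetric] zero_fin_vec.rep_eq fun_eq_iff)
    then show ?case
      by (meson finite.emptyI finite.insertI finite_imp_compact finite_subset)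
  next
    case (Suc n)
    define e where "e = Fin_vec (\<lambda>i. if i = n then 1 else 0)"
    have e: "coord e i = (if i = n then 1 else 0)" for i
      unfolding e_def by (subst Fin_vec_inverse) auto
    have "{x \<in> Rn (Suc n). \<forall>i. \<bar>coord x i\<bar> \<le> M} =
      (\<lambda>(x, t). x + t *\<^sub>R e) ` ({x \<in> Rn n. \<forall>i. \<bar>coord x i\<bar> \<le> M} \<times> {-M..M})" (is "?A = ?F ` ?B")
    proof
      show "?A \<subseteq> ?F ` ?B"
      proof
        fix x assume x: "x \<in> ?A"
        define y where "y = x - coord x n *\<^sub>R e"
        have y: "coord y i = (if i = n then 0 else coord x i)" for i
          by (simp add: y_def minus_fin_vec.rep_eq scaleR_fin_vec.rep_eq e)
        have "(y, coord x n) \<in> ?B"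
          using x M by (auto simp: Rn_def y abs_le_iff) (metis minus_le_iff)
        moreover have "x = ?F (y, coord x n)"
          by (simp add: y_def)
        ultimately show "x \<in> ?F ` ?B" by blast
      qed
      show "?F ` ?B \<subseteq> ?A"
        by (auto simp: Rn_def plus_fin_vec.rep_eq scaleR_fin_vec.rep_eq e abs_le_iff)
    qed
    moreover have "compact (?F ` ?B)"
      by (intro compact_continuous_image compact_Times Suc.IH compact_Icc)
        (auto simp: case_prod_unfold intro!: continuous_intros)
    ultimately show ?case by simp
  qed
qed

lemma abs_coord_le_norm: "\<bar>coord x i\<bar> \<le> norm x"
proof -
  define S where "S = insert i {j. coord x j \<noteq> 0}"
  have "finite S" by (simp add: S_def finite_support)
  then have "(norm x)\<^sup>2 = (\<Sum>j\<in>S. (coord x j)\<^sup>2)"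
    unfolding power2_norm_eq_inner
    by (subst inner_fin_vec_eq_sum[of S]) (auto simp: S_def power2_eq_square)
  also have "\<dots> \<ge> (coord x i)\<^sup>2"
    by (rule member_le_sum) (use \<open>finite S\<close> in \<open>auto simp: S_def\<close>)
  finally show ?thesis
    by (metis abs_le_square_iff abs_norm_cancel)
qed

lemma compact_Rn_subset:
  assumes "Q \<subseteq> Rn n" "closed Q" "bounded Q"
  shows "compact Q"
proof -
  obtain M where M: "norm x \<le> M" if "x \<in> Q" for x
    using assms(3) by (auto simp: bounded_iff)
  have "\<bar>coord x i\<bar> \<le> M" if "x \<in> Q" for x i
    using abs_coord_le_norm M[OF that] by (rule order_trans)
  then have "Q = {x \<in> Rn n. \<forall>i. \<bar>coord x i\<bar> \<le> M} \<inter> Q"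
    using assms(1) by auto
  then show ?thesis
    by (rule ssubst) (rule compact_Int_closed[OF compact_Rn_box assms(2)])
qed

text \<open>\<open>arg_min_on\<close> is a choice operator and is informative only once a minimum is
  attained; compactness provides one. This makes the answers to \<open>Project\<close> genuine
  nearest points.\<close>

lemma arg_min_dist_compact:
  assumes "compact Q" "Q \<noteq> {}"
  shows "arg_min_on (dist x) Q \<in> Q" "y \<in> Q \<Longrightarrow> dist x (arg_min_on (dist x) Q) \<le> dist x y"
proof -
  obtain p where "is_arg_min (dist x) (\<lambda>y. y \<in> Q) p"
    using continuous_attains_inf[OF assms, of "dist x"] continuous_on_dist[of Q "\<lambda>_. x" "\<lambda>y. y"]
    by (auto simp: is_arg_min_linorder)
  then have "is_arg_min (dist x) (\<lambda>y. y \<in> Q) (arg_min_on (dist x) Q)"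
    unfolding arg_min_on_def arg_min_def by (rule someI)
  then show "arg_min_on (dist x) Q \<in> Q"
    "y \<in> Q \<Longrightarrow> dist x (arg_min_on (dist x) Q) \<le> dist x y"
    by (auto simp: is_arg_min_linorder)
qed

section \<open>One extragradient step\<close>

text \<open>The step analysis is coordinate-free; the dimension enters only through compactness of
  \<open>Q\<close>. \<open>G\<close> stays abstract, since its size only affects how deep the
  bisection must go.\<close>

locale tilted_convex_problem =
  fixes Q :: "'a::real_inner set" and f :: "'a \<Rightarrow> real" and g :: "'a \<Rightarrow> 'a"
    and L G R \<gamma>\<^sub>n \<gamma>\<^sub>p :: real
  assumes compact: "compact Q" and nonempty: "Q \<noteq> {}" and convex: "convex Q"
    and dist_le: "\<And>x y. x \<in> Q \<Longrightarrow> y \<in> Q \<Longrightarrow> norm (x - y) \<le> 2 * R"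
    and tilted: "tilted_convex_on Q f g \<gamma>\<^sub>n \<gamma>\<^sub>p"
    and lipschitz_grad: "L-lipschitz_on Q g"
    and lipschitz_fun: "G-lipschitz_on Q f"
begin

section \<open>Consequences of tilting and smoothness\<close>

lemma \<gamma>: "0 < \<gamma>\<^sub>n" "\<gamma>\<^sub>n \<le> 1" "0 < \<gamma>\<^sub>p" "\<gamma>\<^sub>p \<le> 1"
  using tilted by (auto simp: tilted_convex_on_def)

lemma tilted_neg:
  assumes "x \<in> Q" "y \<in> Q" "g x \<bullet> (y - x) \<le> 0"
  shows "f x + (g x \<bullet> (y - x)) / \<gamma>\<^sub>n \<le> f y"
  using tilted assms by (auto simp: tilted_convex_on_def)

lemma tilted_pos:
  assumes "x \<in> Q" "y \<in> Q" "0 \<le> g x \<bullet> (y - x)"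
  shows "f x + \<gamma>\<^sub>p * (g x \<bullet> (y - x)) \<le> f y"
  using tilted assms by (auto simp: tilted_convex_on_def)

lemma L_nonneg: "0 \<le> L"
  using lipschitz_grad by (simp add: lipschitz_on_def)

lemma R_nonneg: "0 \<le> R"
  using dist_le nonempty by (metis diff_self ex_in_conv norm_zero zero_le_mult_iff zero_less_numeral not_numeral_le_zero)

lemma grad_diff_le: "x \<in> Q \<Longrightarrow> y \<in> Q \<Longrightarrow> norm (g x - g y) \<le> L * norm (x - y)"
  using lipschitz_onD[OF lipschitz_grad] by (simp add: dist_norm)

lemma segment_in: "x \<in> Q \<Longrightarrow> y \<in> Q \<Longrightarrow> t \<in> {0..1} \<Longrightarrow> (1 - t) *\<^sub>R x + t *\<^sub>R y \<in> Q"
  using convex by (auto simp: convex_alt)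

text \<open>Mean value theorem on the segment from \<open>x\<close> to \<open>y\<close>, where the
  gradient differs from \<open>g x\<close> by at most \<open>L * norm (y - x)\<close>. Both signs
  matter: \<open>gradient_step_gap\<close> needs an upper estimate at one point and a lower one at
  another.\<close>

lemma smooth:
  assumes x: "x \<in> Q" and y: "y \<in> Q"
  shows "\<bar>f y - f x - g x \<bullet> (y - x)\<bar> \<le> L * (norm (y - x))\<^sup>2"
proof -
  define h where "h t = (1 - t) *\<^sub>R x + t *\<^sub>R y" for t :: real
  have h: "h t \<in> Q" if "t \<in> {0..1}" for t
    unfolding h_def by (rule segment_in[OF x y that])
  have der: "((\<lambda>t. f (h t)) has_derivative (\<lambda>s. g (h t) \<bullet> (s *\<^sub>R (y - x)))) (at t within {0..1})"
    if "0 \<le> t" "t \<le> 1" for t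
  proof (rule has_derivative_in_compose2[of Q f])
    show "(h has_derivative (\<lambda>s. s *\<^sub>R (y - x))) (at t within {0..1})"
      unfolding h_def by (auto intro!: derivative_eq_intros simp: algebra_simps)
    show "(f has_derivative (\<bullet>) (g u)) (at u within Q)" if "u \<in> Q" for u
      using tilted that by (auto simp: tilted_convex_on_def gradient_on_def)
  qed (use h that in auto)
  obtain t where t: "t \<in> {0<..<1}" "f (h 1) - f (h 0) = g (h t) \<bullet> ((1 - 0) *\<^sub>R (y - x))"
    using mvt_simple[OF zero_less_one der] by auto
  then have "f y - f x - g x \<bullet> (y - x) = (g (h t) - g x) \<bullet> (y - x)"
    by (simp add: h_def inner_diff_left)
  also have "\<bar>\<dots>\<bar> \<le> norm (g (h t) - g x) * norm (y - x)"
    by (rule Cauchy_Schwarz_ineq2)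
  also have "\<dots> \<le> (L * norm (h t - x)) * norm (y - x)"
    using t by (intro mult_right_mono grad_diff_le h x) auto
  also have "h t - x = t *\<^sub>R (y - x)"
    by (simp add: h_def algebra_simps)
  also have "(L * norm (t *\<^sub>R (y - x))) * norm (y - x) = t * (L * (norm (y - x))\<^sup>2)"
    using t by (simp add: power2_eq_square)
  also have "\<dots> \<le> L * (norm (y - x))\<^sup>2"
    using t L_nonneg by (intro mult_left_le_one_le) auto
  finally show ?thesis by simp
qed

text \<open>If \<open>Q\<close> is flat, the component of \<open>g\<close> normal to \<open>Q\<close> is arbitrary, so only directional
  derivatives along \<open>Q\<close> can be bounded.\<close>

lemma directional_derivative_le:
  assumes x: "x \<in> Q" and y: "y \<in> Q"
  shows "\<bar>g x \<bullet> (y - x)\<bar> \<le> (G + 2 * L * R) * norm (y - x)"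
proof -
  have "\<bar>f y - f x\<bar> \<le> G * norm (y - x)"
    using lipschitz_onD[OF lipschitz_fun y x] by (simp add: dist_norm)
  moreover have "L * (norm (y - x))\<^sup>2 \<le> 2 * L * R * norm (y - x)"
    using mult_left_mono[OF mult_right_mono[OF dist_le[OF y x] norm_ge_zero[of "y - x"]] L_nonneg]
    by (simp add: power2_eq_square mult_ac)
  ultimately show ?thesis
    using smooth[OF x y] by (simp add: algebra_simps)
qed

section \<open>Projection onto \<open>Q\<close>, minimizers and the initial gap\<close>

definition proj :: "'a \<Rightarrow> 'a"
  where "proj x = arg_min_on (dist x) Q"

lemma proj_in: "proj x \<in> Q"
  unfolding proj_def by (rule arg_min_dist_compact[OF compact nonempty])

lemma proj_inner_le: "y \<in> Q \<Longrightarrow> (x - proj x) \<bullet> (y - proj x) \<le> 0"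
  using any_closest_point_dot[OF convex compact_imp_closed[OF compact] proj_in, of y x x]
    arg_min_dist_compact(2)[OF compact nonempty, of _ x] by (simp add: proj_def)

lemma proj_nonexpansive: "norm (proj x - proj y) \<le> norm (x - y)"
proof -
  \<comment> \<open>Sum of the two variational inequalities, each tested at the other
    projection.\<close>
  have "(norm (proj x - proj y))\<^sup>2 \<le> (x - y) \<bullet> (proj x - proj y)"
    using proj_inner_le[OF proj_in, of x y] proj_inner_le[OF proj_in, of y x]
    by (simp add: power2_norm_eq_inner inner_diff_left inner_diff_right inner_commute)
  also have "\<dots> \<le> norm (x - y) * norm (proj x - proj y)"
    by (rule norm_cauchy_schwarz)
  finally show ?thesis
    by (cases "proj x = proj y") (auto simp: power2_eq_square)
qed

lemma ex_minimizer: "\<exists>m\<in>Q. \<forall>y\<in>Q. f m \<le> f y"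
  using continuous_attains_inf[OF compact nonempty lipschitz_on_continuous_on[OF lipschitz_fun]] .

text \<open>Substitute for first-order convexity, at the price of the factor
  \<open>\<gamma>\<^sub>n\<close> from negative tilting. The other sign cannot occur, as positive
  tilting would then put \<open>f x\<close> strictly below \<open>f m\<close>.\<close>

lemma gap_le_directional_derivative:
  assumes x: "x \<in> Q" and m: "m \<in> Q" "\<forall>y\<in>Q. f m \<le> f y"
  shows "\<gamma>\<^sub>n * (f x - f m) \<le> g x \<bullet> (x - m)"
proof (cases "g x \<bullet> (m - x) \<le> 0")
  case True
  from tilted_neg[OF x m(1) this] \<gamma>(1) show ?thesis
    by (simp add: field_simps inner_diff_right)
next
  case False
  then have "0 < \<gamma>\<^sub>p * (g x \<bullet> (m - x))"
    using \<gamma> by simp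
  with tilted_pos[OF x m(1)] False m(2) x show ?thesis by fastforce
qed

text \<open>Controls the starting point of the method. The linear term, bounded by the variational
  inequality at the projection, and the two smoothness errors contribute
  \<open>4 * L * R\<^sup>2\<close> each. The bound is free of \<open>G\<close>, so
  \<open>R\<^sub>g\<close> cannot spoil the initial gap.\<close>

lemma gradient_step_gap:
  assumes x: "x \<in> Q" and m: "m \<in> Q" and L: "0 < L"
  shows "f (proj (x - (1 / L) *\<^sub>R g x)) - f m \<le> 12 * L * R\<^sup>2"
proof -
  define p where "p = proj (x - (1 / L) *\<^sub>R g x)"
  have p: "p \<in> Q" by (simp add: p_def proj_in)
  have sq: "L * (norm (u - v))\<^sup>2 \<le> 4 * L * R\<^sup>2" if "u \<in> Q" "v \<in> Q" for u v
    using mult_left_mono[OF power_mono[OF dist_le[OF that] norm_ge_zero, of 2] L_nonneg]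
    by (simp add: power_mult_distrib)
  have "L * ((x - (1 / L) *\<^sub>R g x - p) \<bullet> (m - p)) \<le> 0"
    using proj_inner_le[OF m, of "x - (1 / L) *\<^sub>R g x"] L by (auto simp: p_def mult_le_0_iff)
  then have "g x \<bullet> (p - m) \<le> L * ((x - p) \<bullet> (p - m))"
    using L by (simp add: inner_diff_left inner_diff_right right_diff_distrib)
  also have "\<dots> \<le> L * (norm (x - p) * norm (p - m))"
    by (intro mult_left_mono norm_cauchy_schwarz L_nonneg)
  also have "\<dots> \<le> L * ((2 * R) * (2 * R))"
    by (intro mult_left_mono mult_mono dist_le x p m L_nonneg) (use R_nonneg in auto)
  finally have "g x \<bullet> (p - m) \<le> 4 * L * R\<^sup>2"
    by (simp add: power2_eq_square)
  then show ?thesis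
    using smooth[OF x p] smooth[OF x m] sq[OF p x] sq[OF m x]
    unfolding p_def[symmetric] by (simp add: inner_diff_right abs_le_iff)
qed

section \<open>The trial point along the search interval\<close>

definition trial :: "real \<Rightarrow> 'a \<Rightarrow> 'a \<Rightarrow> real \<Rightarrow> 'a"
  where "trial \<eta> y z \<tau> =
    (1 - \<tau>) *\<^sub>R y + \<tau> *\<^sub>R proj (z - \<eta> *\<^sub>R g ((1 - \<tau>) *\<^sub>R y + \<tau> *\<^sub>R z))"

text \<open>Its sign decides which kind of tilting bounds \<open>f x - f y\<close> at the trial
  point \<open>x\<close>.\<close>

definition slope :: "real \<Rightarrow> 'a \<Rightarrow> 'a \<Rightarrow> real \<Rightarrow> real"
  where "slope \<eta> y z \<tau> = g (trial \<eta> y z \<tau>) \<bullet> (trial \<eta> y z \<tau> - y)"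

lemma trial_in: "y \<in> Q \<Longrightarrow> \<tau> \<in> {0..1} \<Longrightarrow> trial \<eta> y z \<tau> \<in> Q"
  unfolding trial_def by (intro segment_in proj_in)

text \<open>The predictor alone moves at a rate of order \<open>\<eta> * L * R\<close>, which may be
  large; in the trial point it carries the weight \<open>s\<close>, and
  \<open>\<eta> * L * s \<le> 1\<close> absorbs the factor.\<close>

lemma trial_lipschitz:
  assumes y: "y \<in> Q" and z: "z \<in> Q" and \<eta>: "0 \<le> \<eta>" "\<eta> * L * s \<le> 1"
    and s: "s \<in> {0..1}" and t: "t \<in> {0..1}"
  shows "norm (trial \<eta> y z s - trial \<eta> y z t) \<le> 4 * R * \<bar>s - t\<bar>"
proof -
  define x where "x t = (1 - t) *\<^sub>R y + t *\<^sub>R z" for t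
  define w where "w t = proj (z - \<eta> *\<^sub>R g (x t))" for t
  have x: "x t \<in> Q" if "t \<in> {0..1}" for t
    unfolding x_def by (rule segment_in[OF y z that])
  have "norm (w s - w t) \<le> norm ((z - \<eta> *\<^sub>R g (x s)) - (z - \<eta> *\<^sub>R g (x t)))"
    unfolding w_def by (rule proj_nonexpansive)
  also have "\<dots> = \<eta> * norm (g (x s) - g (x t))"
    using \<eta> by (simp add: norm_minus_commute flip: scaleR_diff_right)
  also have "\<dots> \<le> \<eta> * (L * norm (x s - x t))"
    by (intro mult_left_mono grad_diff_le x s t \<eta>)
  also have "x s - x t = (s - t) *\<^sub>R (z - y)"
    by (simp add: x_def algebra_simps)
  also have "\<eta> * (L * norm ((s - t) *\<^sub>R (z - y))) \<le> \<eta> * (L * (\<bar>s - t\<bar> * (2 * R)))"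
    using dist_le[OF z y] by (auto intro!: mult_left_mono \<eta> L_nonneg)
  finally have "s * norm (w s - w t) \<le> s * (\<eta> * (L * (\<bar>s - t\<bar> * (2 * R))))"
    using s by (intro mult_left_mono) auto
  also have "\<dots> = (\<eta> * L * s) * (\<bar>s - t\<bar> * (2 * R))"
    by simp
  also have "\<dots> \<le> 1 * (\<bar>s - t\<bar> * (2 * R))"
    by (intro mult_right_mono \<eta>) (use R_nonneg in auto)
  finally have 1: "s * norm (w s - w t) \<le> \<bar>s - t\<bar> * (2 * R)" by simp
  \<comment> \<open>The step condition is known for \<open>s\<close>, so the change of the predictor
    is paired with \<open>s\<close> and not with \<open>t\<close>.\<close>
  have "trial \<eta> y z s - trial \<eta> y z t = (s - t) *\<^sub>R (w t - y) + s *\<^sub>R (w s - w t)"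
    by (simp add: trial_def x_def w_def algebra_simps)
  also have "norm \<dots> \<le> \<bar>s - t\<bar> * norm (w t - y) + s * norm (w s - w t)"
    by (rule norm_triangle_le) (use s in simp)
  also have "\<dots> \<le> \<bar>s - t\<bar> * (2 * R) + \<bar>s - t\<bar> * (2 * R)"
    using 1 dist_le[OF _ y] by (intro add_mono mult_left_mono) (auto simp: w_def proj_in)
  finally show ?thesis by (simp add: algebra_simps)
qed

lemma slope_lipschitz:
  assumes y: "y \<in> Q" and z: "z \<in> Q" and \<eta>: "0 \<le> \<eta>" "\<eta> * L * s \<le> 1"
    and s: "s \<in> {0..1}" and t: "t \<in> {0..1}"
  shows "\<bar>slope \<eta> y z s - slope \<eta> y z t\<bar> \<le> 4 * R * (G + 4 * L * R) * \<bar>s - t\<bar>"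
proof -
  define u v where "u = trial \<eta> y z s" and "v = trial \<eta> y z t"
  have u: "u \<in> Q" and v: "v \<in> Q"
    unfolding u_def v_def by (intro trial_in y s t)+
  have uv: "norm (u - v) \<le> 4 * R * \<bar>s - t\<bar>"
    unfolding u_def v_def by (rule trial_lipschitz[OF y z \<eta> s t])
  have G: "0 \<le> G"
    using lipschitz_fun by (simp add: lipschitz_on_def)
  \<comment> \<open>No norm bound on \<open>g v\<close> is available, so \<open>g v\<close> is
    paired with \<open>u - v\<close>, a direction between two points of \<open>Q\<close>.\<close>
  have "slope \<eta> y z s - slope \<eta> y z t = (g u - g v) \<bullet> (u - y) + g v \<bullet> (u - v)"
    by (simp add: slope_def u_def v_def inner_diff_left inner_diff_right)
  also have "\<bar>\<dots>\<bar> \<le> norm (g u - g v) * norm (u - y) + (G + 2 * L * R) * norm (u - v)"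
    using Cauchy_Schwarz_ineq2[of "g u - g v" "u - y"] directional_derivative_le[OF v u] by linarith
  also have "\<dots> \<le> (L * norm (u - v)) * (2 * R) + (G + 2 * L * R) * norm (u - v)"
    by (intro add_mono mult_mono grad_diff_le dist_le u v y order_refl) (use L_nonneg in auto)
  also have "\<dots> = (G + 4 * L * R) * norm (u - v)"
    by (simp add: algebra_simps)
  also have "\<dots> \<le> (G + 4 * L * R) * (4 * R * \<bar>s - t\<bar>)"
    using G L_nonneg R_nonneg by (intro mult_left_mono uv) auto
  finally show ?thesis by (simp add: mult_ac)
qed

text \<open>The parameter \<open>c = \<eta> (1 - \<tau>) / (\<tau> A)\<close> runs from \<open>1 / \<gamma>\<^sub>n\<close> down to \<open>\<gamma>\<^sub>p\<close> as \<open>\<tau>\<close> runs through the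
  search interval; the two kinds of tilting supply the inequality at its two ends, and a vanishing
  slope supplies it in between.\<close>

lemma search_inequality:
  assumes y: "y \<in> Q" and x: "x \<in> Q"
    and c: "\<gamma>\<^sub>p \<le> c" "c \<le> 1 / \<gamma>\<^sub>n" and \<delta>: "0 \<le> \<delta>"
    and "c = 1 / \<gamma>\<^sub>n \<and> 0 \<le> g x \<bullet> (x - y) \<or> c = \<gamma>\<^sub>p \<and> g x \<bullet> (x - y) \<le> 0 \<or> \<bar>g x \<bullet> (x - y)\<bar> \<le> \<delta>"
  shows "f x - f y \<le> c * (g x \<bullet> (x - y)) + \<delta> / \<gamma>\<^sub>n"
proof -
  define s where "s = g x \<bullet> (x - y)"
  have s: "g x \<bullet> (y - x) = - s" by (simp add: s_def inner_diff_right)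
  have pos: "f x - f y \<le> s / \<gamma>\<^sub>n" if "0 \<le> s"
    using tilted_neg[OF x y] that by (simp add: s)
  have neg: "f x - f y \<le> \<gamma>\<^sub>p * s" if "s \<le> 0"
    using tilted_pos[OF x y] that by (simp add: s)
  have \<delta>': "0 \<le> \<delta> / \<gamma>\<^sub>n" using \<delta> \<gamma> by simp
  have c0: "0 \<le> c" using c \<gamma> by linarith
  \<comment> \<open>A small slope costs at most \<open>\<delta> / \<gamma>\<^sub>n\<close>: if
    \<open>0 \<le> s\<close>, then \<open>f x - f y \<le> s / \<gamma>\<^sub>n\<close>; if
    \<open>s \<le> 0\<close>, then \<open>f x - f y \<le> 0\<close>, while
    \<open>c \<le> 1 / \<gamma>\<^sub>n\<close> keeps \<open>c * s\<close> above
    \<open>- \<delta> / \<gamma>\<^sub>n\<close>.\<close>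
  consider "c = 1 / \<gamma>\<^sub>n" "0 \<le> s" | "c = \<gamma>\<^sub>p" "s \<le> 0" | "\<bar>s\<bar> \<le> \<delta>" "0 \<le> s" | "\<bar>s\<bar> \<le> \<delta>" "s \<le> 0"
    using assms(6) unfolding s_def[symmetric] by linarith
  then have "f x - f y \<le> c * s + \<delta> / \<gamma>\<^sub>n"
  proof cases
    case 1
    then show ?thesis using pos \<delta>' by simp
  next
    case 2
    then show ?thesis using neg \<delta>' by simp
  next
    case 3
    have "s / \<gamma>\<^sub>n \<le> \<delta> / \<gamma>\<^sub>n" using 3 \<gamma> by (intro divide_right_mono) auto
    then show ?thesis using pos 3 c0 by (smt (verit) mult_nonneg_nonneg)
  next
    case 4
    have "c * - s \<le> (1 / \<gamma>\<^sub>n) * \<delta>" using 4 \<gamma> c by (intro mult_mono) auto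
    moreover have "\<gamma>\<^sub>p * s \<le> 0" using 4 \<gamma> by (simp add: mult_le_0_iff)
    ultimately show ?thesis using neg 4 by simp
  qed
  then show ?thesis by (simp add: s_def)
qed

text \<open>A mirror-prox estimate bounds \<open>\<eta> * (g x \<bullet> (w - m))\<close>. The
  choice of \<open>c\<close> splits this term into a part along \<open>x - m\<close>, which
  dominates the gap, and a part along \<open>x - y\<close>, which the search inequality
  handles.\<close>

lemma extragradient_step:
  assumes y: "y \<in> Q" and z: "z \<in> Q" and m: "m \<in> Q" "\<forall>u\<in>Q. f m \<le> f u"
    and A: "0 < A" and \<eta>: "0 < \<eta>" and \<tau>: "0 < \<tau>" "\<tau> \<le> 1" "\<eta> * L * \<tau> \<le> 1"
    and c: "A * c = \<eta> * (1 - \<tau>) / \<tau>"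
    and x_def: "x = trial \<eta> y z \<tau>"
    and search: "f x - f y \<le> c * (g x \<bullet> (x - y)) + e"
  shows "(A + \<eta> * \<gamma>\<^sub>n) * (f x - f m) + (norm (proj (z - \<eta> *\<^sub>R g x) - m))\<^sup>2 / 2 \<le>
    A * (f y - f m) + (norm (z - m))\<^sup>2 / 2 + A * e"
proof -
  define v where "v = (1 - \<tau>) *\<^sub>R y + \<tau> *\<^sub>R z"
  define w where "w = proj (z - \<eta> *\<^sub>R g v)"
  define p where "p = proj (z - \<eta> *\<^sub>R g x)"
  have x: "x = (1 - \<tau>) *\<^sub>R y + \<tau> *\<^sub>R w"
    by (simp add: x_def trial_def w_def v_def)
  have in_Q: "v \<in> Q" "w \<in> Q" "p \<in> Q" "x \<in> Q"
    using segment_in[OF y z, of \<tau>] trial_in[OF y, of \<tau>] \<tau>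
    by (auto simp: v_def w_def p_def x_def proj_in)
  have P1: "\<eta> * (g v \<bullet> (w - p)) \<le> (z - w) \<bullet> (w - p)"
    using proj_inner_le[OF in_Q(3), of "z - \<eta> *\<^sub>R g v"] unfolding w_def[symmetric]
    by (simp add: inner_diff_left inner_diff_right algebra_simps)
  have P2: "\<eta> * (g x \<bullet> (p - m)) \<le> (z - p) \<bullet> (p - m)"
    using proj_inner_le[OF m(1), of "z - \<eta> *\<^sub>R g x"] unfolding p_def[symmetric]
    by (simp add: inner_diff_left inner_diff_right algebra_simps)
  \<comment> \<open>\<open>x\<close> and \<open>v\<close> are mixtures with the same weight
    \<open>\<tau>\<close>, so the gradient mismatch carries the factor
    \<open>\<eta> * L * \<tau> \<le> 1\<close>.\<close>
  have "(g x - g v) \<bullet> (w - p) \<le> norm (g x - g v) * norm (w - p)"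
    by (rule norm_cauchy_schwarz)
  also have "\<dots> \<le> (L * norm (x - v)) * norm (w - p)"
    by (intro mult_right_mono grad_diff_le in_Q) auto
  also have "x - v = \<tau> *\<^sub>R (w - z)"
    by (simp add: x v_def algebra_simps)
  finally have "\<eta> * ((g x - g v) \<bullet> (w - p)) \<le> \<eta> * (L * norm (\<tau> *\<^sub>R (w - z)) * norm (w - p))"
    using \<eta> by (intro mult_left_mono) auto
  also have "\<dots> = (\<eta> * L * \<tau>) * (norm (w - z) * norm (w - p))"
    using \<tau> by simp
  also have "\<dots> \<le> 1 * (norm (w - z) * norm (w - p))"
    by (intro mult_right_mono \<tau>) auto
  also have "\<dots> \<le> (norm (w - z))\<^sup>2 / 2 + (norm (w - p))\<^sup>2 / 2"
    using sum_squares_bound[of "norm (w - z)" "norm (w - p)"] by simp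
  finally have P3: "\<eta> * ((g x - g v) \<bullet> (w - p)) \<le> (norm (w - z))\<^sup>2 / 2 + (norm (w - p))\<^sup>2 / 2" .
  have "\<eta> * (g x \<bullet> (w - m)) =
      \<eta> * (g x \<bullet> (p - m)) + \<eta> * (g v \<bullet> (w - p)) + \<eta> * ((g x - g v) \<bullet> (w - p))"
    by (simp add: inner_diff_left inner_diff_right algebra_simps)
  also have "\<dots> \<le> (z - p) \<bullet> (p - m) + (z - w) \<bullet> (w - p) + ((norm (w - z))\<^sup>2 / 2 + (norm (w - p))\<^sup>2 / 2)"
    using P1 P2 P3 by linarith
  \<comment> \<open>Polarising both inner products, the squares of \<open>z - p\<close>,
    \<open>w - z\<close> and \<open>w - p\<close> cancel.\<close>
  also have "\<dots> = (norm (z - m))\<^sup>2 / 2 - (norm (p - m))\<^sup>2 / 2"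
    by (simp add: power2_norm_eq_inner inner_diff_left inner_diff_right inner_commute field_simps)
  finally have mirror: "\<eta> * (g x \<bullet> (w - m)) \<le> (norm (z - m))\<^sup>2 / 2 - (norm (p - m))\<^sup>2 / 2" .
  \<comment> \<open>Here \<open>w - x\<close> is \<open>1 - \<tau>\<close> times
    \<open>w - y\<close> and \<open>x - y\<close> is \<open>\<tau>\<close> times
    \<open>w - y\<close>, which is the ratio in \<open>c\<close>.\<close>
  have "\<eta> *\<^sub>R (w - m) = \<eta> *\<^sub>R (x - m) + (A * c) *\<^sub>R (x - y)"
  proof -
    have "x - y = \<tau> *\<^sub>R (w - y)" by (simp add: x algebra_simps)
    then have "(A * c) *\<^sub>R (x - y) = (\<eta> * (1 - \<tau>)) *\<^sub>R (w - y)"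
      using \<tau> by (simp add: c)
    then show ?thesis
      by (simp add: x algebra_simps)
  qed
  then have "\<eta> * (g x \<bullet> (w - m)) = \<eta> * (g x \<bullet> (x - m)) + A * (c * (g x \<bullet> (x - y)))"
    by (metis inner_add_right inner_scaleR_right mult.assoc)
  moreover have "\<eta> * (\<gamma>\<^sub>n * (f x - f m)) \<le> \<eta> * (g x \<bullet> (x - m))"
    using \<eta> by (intro mult_left_mono gap_le_directional_derivative in_Q m) auto
  moreover have "A * (f x - f y - e) \<le> A * (c * (g x \<bullet> (x - y)))"
    using A search by (intro mult_left_mono) auto
  ultimately show ?thesis
    using mirror unfolding p_def[symmetric] by (simp add: algebra_simps)
qed

end

section \<open>The algorithm\<close>

text \<open>Subroutines are written in continuation-passing style, the continuation receiving the computed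
  value; \<open>N\<close> counts their oracle queries.\<close>

definition computes ::
    "'a::metric_space set \<Rightarrow> ('a \<Rightarrow> real) \<Rightarrow> ('a \<Rightarrow> 'a) \<Rightarrow> (('b \<Rightarrow> 'a algorithm) \<Rightarrow> 'a algorithm) \<Rightarrow>
      'b \<Rightarrow> nat \<Rightarrow> bool"
  where "computes Q f g M v N \<longleftrightarrow>
    (\<forall>k x N'. runs Q f g (k v) x N' \<longrightarrow> runs Q f g (M k) x (N + N'))"

lemma computesD: "computes Q f g M v N \<Longrightarrow> runs Q f g (k v) x N' \<Longrightarrow> runs Q f g (M k) x (N + N')"
  by (simp add: computes_def)

lemma computes_return: "computes Q f g (\<lambda>k. k v) v 0"
  by (simp add: computes_def)

lemma computes_bind:
  assumes "computes Q f g M v N" "computes Q f g (F v) w N'"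
  shows "computes Q f g (\<lambda>k. M (\<lambda>x. F x k)) w (N + N')"
  using assms unfolding computes_def by (metis add.assoc)

section \<open>Bisection for a sign change of the slope\<close>

primrec bisect ::
    "(real \<Rightarrow> (real \<Rightarrow> 'a algorithm) \<Rightarrow> 'a algorithm) \<Rightarrow> nat \<Rightarrow> real \<Rightarrow> real \<Rightarrow> (real \<Rightarrow> 'a algorithm) \<Rightarrow> 'a algorithm"
  where
    "bisect ev 0 lo hi k = k lo"
  | "bisect ev (Suc j) lo hi k = ev ((lo + hi) / 2)
      (\<lambda>s. if s < 0 then bisect ev j ((lo + hi) / 2) hi k else bisect ev j lo ((lo + hi) / 2) k)"

text \<open>At \<open>lo\<close>, where \<open>c = 1 / \<gamma>\<^sub>n\<close>, a nonnegative slope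
  already suffices, and at \<open>hi\<close>, where \<open>c = \<gamma>\<^sub>p\<close>, a
  nonpositive one; failing both, the ends bracket a sign change.\<close>

definition search ::
    "(real \<Rightarrow> (real \<Rightarrow> 'a algorithm) \<Rightarrow> 'a algorithm) \<Rightarrow> nat \<Rightarrow> real \<Rightarrow> real \<Rightarrow> (real \<Rightarrow> 'a algorithm) \<Rightarrow> 'a algorithm"
  where "search ev J lo hi k = ev lo (\<lambda>s. if 0 \<le> s then k lo
    else ev hi (\<lambda>s'. if s' \<le> 0 then k hi else bisect ev J lo hi k))"

text \<open>On a bracket with a sign change, \<open>\<bar>\<psi> lo\<bar>\<close> is at most
  \<open>\<psi> hi - \<psi> lo\<close>, hence at most \<open>\<Lambda>\<close> times its length.
  Each halving costs one evaluation.\<close>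

lemma computes_bisect:
  assumes "lo \<le> hi" and "\<And>t. t \<in> {lo..hi} \<Longrightarrow> computes Q f g (ev t) (\<psi> t) m"
    and "\<And>s t. s \<in> {lo..hi} \<Longrightarrow> t \<in> {lo..hi} \<Longrightarrow> \<bar>\<psi> s - \<psi> t\<bar> \<le> \<Lambda> * \<bar>s - t\<bar>"
    and "\<psi> lo < 0" "0 \<le> \<psi> hi"
  shows "\<exists>t\<in>{lo..hi}. computes Q f g (bisect ev J lo hi) t (m * J) \<and> \<bar>\<psi> t\<bar> \<le> \<Lambda> * (hi - lo) / 2 ^ J"
  using assms
proof (induction J arbitrary: lo hi)
  case 0
  then have "\<bar>\<psi> lo\<bar> \<le> \<Lambda> * (hi - lo)"
    using "0.prems"(3)[of lo hi] by auto
  moreover have "computes Q f g (bisect ev 0 lo hi) lo (m * 0)"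
    by (simp add: computes_def)
  ultimately show ?case
    using "0.prems"(1) by (intro bexI[of _ lo]) (auto simp del: bisect.simps)
next
  case (Suc J)
  define mid where "mid = (lo + hi) / 2"
  have mid: "lo \<le> mid" "mid \<le> hi" "hi - mid = (hi - lo) / 2" "mid - lo = (hi - lo) / 2"
    using Suc.prems(1) by (auto simp: mid_def field_simps)
  have ev: "computes Q f g (ev mid) (\<psi> mid) m"
    using Suc.prems(2) mid by simp
  show ?case
  proof (cases "\<psi> mid < 0")
    case True
    obtain t where t: "t \<in> {mid..hi}" "computes Q f g (bisect ev J mid hi) t (m * J)"
      "\<bar>\<psi> t\<bar> \<le> \<Lambda> * (hi - mid) / 2 ^ J"
      using Suc.IH[of mid hi] Suc.prems mid True by force
    \<comment> \<open>The conditional is applied to \<open>k\<close> as a whole, which is the shape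
      required by \<open>computes_bind\<close>.\<close>
    have "computes Q f g (\<lambda>k. ev mid (\<lambda>s. (if s < 0 then bisect ev J mid hi else bisect ev J lo mid) k)) t (m + m * J)"
      by (rule computes_bind[OF ev]) (use True t in simp)
    then have "computes Q f g (bisect ev (Suc J) lo hi) t (m * Suc J)"
      unfolding bisect.simps mid_def[symmetric] computes_def by (simp add: if_distribR)
    then show ?thesis
      using t mid by (intro bexI[of _ t]) (auto simp: mid(3) simp del: bisect.simps)
  next
    case False
    obtain t where t: "t \<in> {lo..mid}" "computes Q f g (bisect ev J lo mid) t (m * J)"
      "\<bar>\<psi> t\<bar> \<le> \<Lambda> * (mid - lo) / 2 ^ J"
      using Suc.IH[of lo mid] Suc.prems mid False by force
    have "computes Q f g (\<lambda>k. ev mid (\<lambda>s. (if s < 0 then bisect ev J mid hi else bisect ev J lo mid) k)) t (m + m * J)"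
      by (rule computes_bind[OF ev]) (use False t in simp)
    then have "computes Q f g (bisect ev (Suc J) lo hi) t (m * Suc J)"
      unfolding bisect.simps mid_def[symmetric] computes_def by (simp add: if_distribR)
    then show ?thesis
      using t mid by (intro bexI[of _ t]) (auto simp: mid(4) simp del: bisect.simps)
  qed
qed

text \<open>\<open>J + 2\<close> counts the two end tests and the \<open>J\<close> halvings.\<close>

lemma computes_search:
  assumes "lo \<le> hi" and ev: "\<And>t. t \<in> {lo..hi} \<Longrightarrow> computes Q f g (ev t) (\<psi> t) m"
    and "\<And>s t. s \<in> {lo..hi} \<Longrightarrow> t \<in> {lo..hi} \<Longrightarrow> \<bar>\<psi> s - \<psi> t\<bar> \<le> \<Lambda> * \<bar>s - t\<bar>"
  shows "\<exists>t\<in>{lo..hi}. \<exists>N\<le>m * (J + 2). computes Q f g (search ev J lo hi) t N \<and>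
    (t = lo \<and> 0 \<le> \<psi> lo \<or> t = hi \<and> \<psi> hi \<le> 0 \<or> \<bar>\<psi> t\<bar> \<le> \<Lambda> * (hi - lo) / 2 ^ J)"
proof -
  have lo: "computes Q f g (ev lo) (\<psi> lo) m" and hi: "computes Q f g (ev hi) (\<psi> hi) m"
    using assms(1) by (auto intro: ev)
  define M where "M s' k = (if s' \<le> 0 then k hi else bisect ev J lo hi k)" for s' :: real and k
  have search: "search ev J lo hi k = ev lo (\<lambda>s. if 0 \<le> s then k lo else ev hi (\<lambda>s'. M s' k))" for k
    unfolding search_def M_def ..
  consider "0 \<le> \<psi> lo" | "\<psi> lo < 0" "\<psi> hi \<le> 0" | "\<psi> lo < 0" "0 < \<psi> hi" by linarith
  then show ?thesis
  proof cases
    case 1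
    have "computes Q f g (search ev J lo hi) lo (m + 0)"
      unfolding search by (rule computes_bind[OF lo]) (use 1 in \<open>simp add: computes_return\<close>)
    then show ?thesis
      using 1 assms(1) by (intro bexI[of _ lo] exI[of _ m]) auto
  next
    case 2
    have "computes Q f g (\<lambda>k. ev hi (\<lambda>s'. M s' k)) hi (m + 0)"
      by (rule computes_bind[OF hi]) (use 2 in \<open>simp add: M_def computes_return\<close>)
    then have "computes Q f g (search ev J lo hi) hi (m + (m + 0))"
      unfolding search by (intro computes_bind[OF lo]) (use 2 in simp)
    then show ?thesis
      using 2 assms(1) by (intro bexI[of _ hi] exI[of _ "m + (m + 0)"]) auto
  next
    case 3
    obtain t where t: "t \<in> {lo..hi}" "computes Q f g (bisect ev J lo hi) t (m * J)"
      "\<bar>\<psi> t\<bar> \<le> \<Lambda> * (hi - lo) / 2 ^ J"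
      using computes_bisect[OF assms, where J = J] 3 by force
    have "computes Q f g (\<lambda>k. ev hi (\<lambda>s'. M s' k)) t (m + m * J)"
      by (rule computes_bind[OF hi]) (use 3 t in \<open>simp add: M_def\<close>)
    then have "computes Q f g (search ev J lo hi) t (m + (m + m * J))"
      unfolding search by (intro computes_bind[OF lo]) (use 3 in simp)
    then show ?thesis
      using t by (intro bexI[of _ t] exI[of _ "m + (m + m * J)"]) auto
  qed
qed

section \<open>The accelerated method as an interaction tree\<close>

definition extragradient ::
    "real \<Rightarrow> 'a::real_inner \<Rightarrow> 'a \<Rightarrow> real \<Rightarrow> ('a \<times> 'a \<Rightarrow> 'a algorithm) \<Rightarrow> 'a algorithm"
  where "extragradient \<eta> y z \<tau> k =
    Query ((1 - \<tau>) *\<^sub>R y + \<tau> *\<^sub>R z) (\<lambda>_ u. Project (z - \<eta> *\<^sub>R u) (\<lambda>w.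
      Query ((1 - \<tau>) *\<^sub>R y + \<tau> *\<^sub>R w) (\<lambda>_ v. k ((1 - \<tau>) *\<^sub>R y + \<tau> *\<^sub>R w, v))))"

text \<open>The search hands over only \<open>\<tau>\<close>, so the extragradient pass is repeated
  at the chosen value, for two more queries.\<close>

definition accelerated_step ::
    "real \<Rightarrow> nat \<Rightarrow> real \<Rightarrow> real \<Rightarrow> 'a::real_inner \<times> 'a \<Rightarrow> ('a \<times> 'a \<Rightarrow> 'a algorithm) \<Rightarrow> 'a algorithm"
  where "accelerated_step \<eta> J lo hi s k = (case s of (y, z) \<Rightarrow>
    search (\<lambda>\<tau> k. extragradient \<eta> y z \<tau> (\<lambda>p. k (snd p \<bullet> (fst p - y)))) J lo hi
      (\<lambda>\<tau>. extragradient \<eta> y z \<tau> (\<lambda>p. Project (z - \<eta> *\<^sub>R snd p) (\<lambda>w. k (fst p, w)))))"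

text \<open>The last step sits in the continuation, so that induction on the number of steps follows
  the step index.\<close>

primrec iterate :: "(nat \<Rightarrow> 's \<Rightarrow> ('s \<Rightarrow> 'a algorithm) \<Rightarrow> 'a algorithm) \<Rightarrow> nat \<Rightarrow> 's \<Rightarrow> ('s \<Rightarrow> 'a algorithm) \<Rightarrow> 'a algorithm"
  where
    "iterate M 0 s k = k s"
  | "iterate M (Suc j) s k = iterate M j s (\<lambda>s'. M j s' k)"

text \<open>Quadratic growth gives the accelerated rate \<open>1 / K\<^sup>2\<close>; the prefactor
  is the largest one, up to constants, that \<open>step_size_le\<close> allows.\<close>

definition weight :: "real \<Rightarrow> real \<Rightarrow> real \<Rightarrow> nat \<Rightarrow> real"
  where "weight L \<gamma>\<^sub>n \<gamma>\<^sub>p j = \<gamma>\<^sub>n\<^sup>2 * \<gamma>\<^sub>p / (9 * L) * (real j + 1)\<^sup>2"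

text \<open>The increment of \<open>weight\<close> divided by
  \<open>\<gamma>\<^sub>n\<close>.\<close>

definition step_size :: "real \<Rightarrow> real \<Rightarrow> real \<Rightarrow> nat \<Rightarrow> real"
  where "step_size L \<gamma>\<^sub>n \<gamma>\<^sub>p j = \<gamma>\<^sub>n * \<gamma>\<^sub>p / (9 * L) * (2 * real j + 3)"

text \<open>Projecting 0 yields a point where a query is admissible. The ends of the search interval
  solve \<open>\<eta> * (1 - \<tau>) / (\<tau> * A) = 1 / \<gamma>\<^sub>n\<close> and
  \<open>\<eta> * (1 - \<tau>) / (\<tau> * A) = \<gamma>\<^sub>p\<close>.\<close>

definition accelerated_method :: "real \<Rightarrow> real \<Rightarrow> real \<Rightarrow> nat \<Rightarrow> nat \<Rightarrow> 'a::real_inner algorithm"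
  where "accelerated_method L \<gamma>\<^sub>n \<gamma>\<^sub>p J K =
    Project 0 (\<lambda>x. Query x (\<lambda>_ u. Project (x - (1 / L) *\<^sub>R u) (\<lambda>y.
      iterate (\<lambda>j. let \<eta> = step_size L \<gamma>\<^sub>n \<gamma>\<^sub>p j; A = weight L \<gamma>\<^sub>n \<gamma>\<^sub>p j
        in accelerated_step \<eta> J (\<eta> / (\<eta> + A / \<gamma>\<^sub>n)) (\<eta> / (\<eta> + A * \<gamma>\<^sub>p)))
        K (y, y) (\<lambda>s. Output (fst s)))))"

context tilted_convex_problem
begin

section \<open>Query counts and decay of the potential\<close>

lemma computes_extragradient:
  assumes y: "y \<in> Q" and z: "z \<in> Q" and \<tau>: "\<tau> \<in> {0..1}"
  shows "computes Q f g (extragradient \<eta> y z \<tau>) (trial \<eta> y z \<tau>, g (trial \<eta> y z \<tau>)) 2"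
  unfolding computes_def
proof (intro allI impI)
  fix k x N
  assume k: "runs Q f g (k (trial \<eta> y z \<tau>, g (trial \<eta> y z \<tau>))) x N"
  define v w where "v = (1 - \<tau>) *\<^sub>R y + \<tau> *\<^sub>R z" and "w = proj (z - \<eta> *\<^sub>R g v)"
  have t: "trial \<eta> y z \<tau> = (1 - \<tau>) *\<^sub>R y + \<tau> *\<^sub>R w"
    by (simp add: trial_def w_def v_def)
  have "runs Q f g (Query (trial \<eta> y z \<tau>) (\<lambda>_ u. k (trial \<eta> y z \<tau>, u))) x (Suc N)"
    using k by (intro run_query trial_in y \<tau>)
  then have "runs Q f g (Project (z - \<eta> *\<^sub>R g v)
      (\<lambda>w. Query ((1 - \<tau>) *\<^sub>R y + \<tau> *\<^sub>R w) (\<lambda>_ u. k ((1 - \<tau>) *\<^sub>R y + \<tau> *\<^sub>R w, u)))) x (Suc N)"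
    by (intro run_project) (simp add: t w_def proj_def)
  then have "runs Q f g (extragradient \<eta> y z \<tau> k) x (Suc (Suc N))"
    unfolding extragradient_def v_def by (intro run_query segment_in y z \<tau>)
  then show "runs Q f g (extragradient \<eta> y z \<tau> k) x (2 + N)"
    by simp
qed

text \<open>The search costs at most \<open>J + 2\<close> evaluations of two queries each, the final
  pass two more. Lipschitz continuity of the slope turns the depth \<open>J\<close> into the error
  term.\<close>

lemma computes_accelerated_step:
  assumes y: "y \<in> Q" and z: "z \<in> Q" and m: "m \<in> Q" "\<forall>u\<in>Q. f m \<le> f u"
    and A: "0 < A" and \<eta>: "0 < \<eta>" "\<eta>\<^sup>2 * L \<le> A * \<gamma>\<^sub>p"
  shows "\<exists>x\<in>Q. \<exists>p\<in>Q. \<exists>N\<le>2 * J + 6.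
    computes Q f g (accelerated_step \<eta> J (\<eta> / (\<eta> + A / \<gamma>\<^sub>n)) (\<eta> / (\<eta> + A * \<gamma>\<^sub>p)) (y, z)) (x, p) N \<and>
    (A + \<eta> * \<gamma>\<^sub>n) * (f x - f m) + (norm (p - m))\<^sup>2 / 2 \<le>
      A * (f y - f m) + (norm (z - m))\<^sup>2 / 2 + A * (4 * R * (G + 4 * L * R) / 2 ^ J / \<gamma>\<^sub>n)"
proof -
  define lo hi where "lo = \<eta> / (\<eta> + A / \<gamma>\<^sub>n)" and "hi = \<eta> / (\<eta> + A * \<gamma>\<^sub>p)"
  define \<Lambda> where "\<Lambda> = 4 * R * (G + 4 * L * R)"
  have "0 \<le> G"
    using lipschitz_fun by (simp add: lipschitz_on_def)
  then have \<Lambda>: "0 \<le> \<Lambda>"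
    unfolding \<Lambda>_def using L_nonneg R_nonneg by simp
  have pos: "0 < A / \<gamma>\<^sub>n" "0 < A * \<gamma>\<^sub>p" using A \<gamma> by auto
  have le: "A * \<gamma>\<^sub>p \<le> A / \<gamma>\<^sub>n"
  proof -
    have "\<gamma>\<^sub>p * \<gamma>\<^sub>n \<le> 1" using \<gamma> by (simp add: mult_le_one)
    then show ?thesis using A \<gamma> by (simp add: pos_le_divide_eq mult.assoc)
  qed
  have lo0: "0 < lo" and lohi: "lo \<le> hi"
    unfolding lo_def hi_def using pos A \<gamma> \<eta> le
    by (auto intro!: divide_left_mono divide_pos_pos mult_pos_pos add_pos_pos)
  have hi1: "hi \<le> 1"
    unfolding hi_def using pos \<eta> by (simp add: pos_divide_le_eq add_pos_pos)
  \<comment> \<open>The step condition is worst at \<open>hi\<close>, where it reads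
    \<open>\<eta>\<^sup>2 * L \<le> \<eta> + A * \<gamma>\<^sub>p\<close>.\<close>
  have step: "\<eta> * L * t \<le> 1" if "t \<in> {lo..hi}" for t
  proof -
    have "\<eta> * L * t \<le> \<eta> * L * hi"
      using that \<eta> L_nonneg by (intro mult_left_mono) auto
    also have "\<dots> \<le> 1"
      unfolding hi_def using \<eta> pos by (simp add: pos_divide_le_eq power2_eq_square mult_ac)
    finally show ?thesis .
  qed
  have unit: "t \<in> {0..1}" if "t \<in> {lo..hi}" for t
    using that lo0 hi1 by auto
  define ev where "ev \<tau> k = extragradient \<eta> y z \<tau> (\<lambda>p. k (snd p \<bullet> (fst p - y)))" for \<tau> and k :: "real \<Rightarrow> 'a algorithm"
  have ev: "computes Q f g (ev t) (slope \<eta> y z t) 2" if "t \<in> {lo..hi}" for t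
    using computes_bind[OF computes_extragradient[OF y z unit[OF that], where \<eta> = \<eta>],
        of "\<lambda>p k. k (snd p \<bullet> (fst p - y))" "slope \<eta> y z t" 0]
    by (simp add: slope_def computes_return ev_def[abs_def])
  have "\<exists>t\<in>{lo..hi}. \<exists>N\<le>2 * (J + 2). computes Q f g (search ev J lo hi) t N \<and>
    (t = lo \<and> 0 \<le> slope \<eta> y z lo \<or> t = hi \<and> slope \<eta> y z hi \<le> 0 \<or>
      \<bar>slope \<eta> y z t\<bar> \<le> \<Lambda> * (hi - lo) / 2 ^ J)"
  proof (rule computes_search[OF lohi ev])
    show "\<bar>slope \<eta> y z s - slope \<eta> y z t\<bar> \<le> \<Lambda> * \<bar>s - t\<bar>" if "s \<in> {lo..hi}" "t \<in> {lo..hi}" for s t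
      unfolding \<Lambda>_def using that \<eta> by (intro slope_lipschitz y z step unit) auto
  qed
  then obtain t N where t: "t \<in> {lo..hi}" and N: "N \<le> 2 * (J + 2)" "computes Q f g (search ev J lo hi) t N"
    and slope: "t = lo \<and> 0 \<le> slope \<eta> y z lo \<or> t = hi \<and> slope \<eta> y z hi \<le> 0 \<or>
      \<bar>slope \<eta> y z t\<bar> \<le> \<Lambda> * (hi - lo) / 2 ^ J"
    by blast
  define x where "x = trial \<eta> y z t"
  define p where "p = proj (z - \<eta> *\<^sub>R g x)"
  define c where "c = \<eta> * (1 - t) / t / A"
  have t0: "0 < t" "t \<le> 1" using t lo0 hi1 by auto
  \<comment> \<open>In this form \<open>c\<close> visibly decreases in \<open>t\<close>, and its
    values at both ends can be read off.\<close>
  have c_eq: "c = (\<eta> / t - \<eta>) / A"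
    using t0 by (simp add: c_def field_simps)
  have c_lo: "c = 1 / \<gamma>\<^sub>n" if "t = lo"
    unfolding c_eq that lo_def using \<eta> A \<gamma> by simp
  have c_hi: "c = \<gamma>\<^sub>p" if "t = hi"
    unfolding c_eq that hi_def using \<eta> A \<gamma> by simp
  have "\<eta> / t \<le> \<eta> / lo" "\<eta> / hi \<le> \<eta> / t"
    using t t0 lo0 \<eta> by (auto intro!: divide_left_mono)
  moreover have "\<eta> / lo = \<eta> + A / \<gamma>\<^sub>n" "\<eta> / hi = \<eta> + A * \<gamma>\<^sub>p"
    using \<eta> by (auto simp: lo_def hi_def)
  ultimately have c_bounds: "\<gamma>\<^sub>p \<le> c" "c \<le> 1 / \<gamma>\<^sub>n"
    unfolding c_eq using A by (auto simp: pos_le_divide_eq pos_divide_le_eq mult_ac)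
  have "\<Lambda> * (hi - lo) / 2 ^ J \<le> \<Lambda> / 2 ^ J"
    using mult_left_mono[of "hi - lo" 1 \<Lambda>] \<Lambda> lo0 hi1 by (intro divide_right_mono) auto
  then have slope': "c = 1 / \<gamma>\<^sub>n \<and> 0 \<le> g x \<bullet> (x - y) \<or> c = \<gamma>\<^sub>p \<and> g x \<bullet> (x - y) \<le> 0 \<or>
      \<bar>g x \<bullet> (x - y)\<bar> \<le> \<Lambda> / 2 ^ J"
    using slope c_lo c_hi unfolding slope_def x_def by fastforce
  have x_in: "x \<in> Q" unfolding x_def by (intro trial_in y unit t)
  have search: "f x - f y \<le> c * (g x \<bullet> (x - y)) + \<Lambda> / 2 ^ J / \<gamma>\<^sub>n"
    by (rule search_inequality[OF y x_in c_bounds _ slope']) (use \<Lambda> in simp)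
  have Ac: "A * c = \<eta> * (1 - t) / t"
    using A by (simp add: c_def)
  have "(A + \<eta> * \<gamma>\<^sub>n) * (f x - f m) + (norm (p - m))\<^sup>2 / 2 \<le>
      A * (f y - f m) + (norm (z - m))\<^sup>2 / 2 + A * (\<Lambda> / 2 ^ J / \<gamma>\<^sub>n)"
    unfolding p_def by (rule extragradient_step[OF y z m A \<eta>(1) t0 step[OF t] Ac x_def search])
  moreover have "computes Q f g (accelerated_step \<eta> J lo hi (y, z)) (x, p) (N + (2 + 0))"
    unfolding accelerated_step_def prod.case ev_def[symmetric, abs_def]
  proof (rule computes_bind[OF N(2)])
    have "computes Q f g (\<lambda>k. Project (z - \<eta> *\<^sub>R g x) (\<lambda>w. k (x, w))) (x, p) 0"
      unfolding computes_def p_def proj_def by (auto intro: run_project)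
    then show "computes Q f g (\<lambda>k. extragradient \<eta> y z t
        (\<lambda>p. Project (z - \<eta> *\<^sub>R snd p) (\<lambda>w. k (fst p, w)))) (x, p) (2 + 0)"
      using computes_bind[OF computes_extragradient[OF y z unit[OF t], where \<eta> = \<eta>],
          of "\<lambda>p k. Project (z - \<eta> *\<^sub>R snd p) (\<lambda>w. k (fst p, w))" "(x, p)" 0]
      by (simp add: x_def)
  qed
  ultimately show ?thesis
    using x_in proj_in[of "z - \<eta> *\<^sub>R g x"] N(1) unfolding lo_def hi_def \<Lambda>_def p_def
    by (intro bexI[of _ x] bexI[of _ "proj (z - \<eta> *\<^sub>R g x)"] exI[of _ "N + (2 + 0)"]) auto
qed

lemma weight_Suc: "weight L \<gamma>\<^sub>n \<gamma>\<^sub>p j + step_size L \<gamma>\<^sub>n \<gamma>\<^sub>p j * \<gamma>\<^sub>n = weight L \<gamma>\<^sub>n \<gamma>\<^sub>p (Suc j)"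
  by (simp add: weight_def step_size_def algebra_simps power2_eq_square add_divide_distrib)

lemma step_size_le:
  assumes "0 < L"
  shows "(step_size L \<gamma>\<^sub>n \<gamma>\<^sub>p j)\<^sup>2 * L \<le> weight L \<gamma>\<^sub>n \<gamma>\<^sub>p j * \<gamma>\<^sub>p"
proof -
  have "(step_size L \<gamma>\<^sub>n \<gamma>\<^sub>p j)\<^sup>2 * L = (\<gamma>\<^sub>n * \<gamma>\<^sub>p)\<^sup>2 / (81 * L) * (2 * real j + 3)\<^sup>2"
    using assms by (simp add: step_size_def power2_eq_square)
  \<comment> \<open>\<open>2 * j + 3 \<le> 3 * (j + 1)\<close>, with equality at
    \<open>j = 0\<close>; this fixes the 9 in the weights.\<close>
  also have "\<dots> \<le> (\<gamma>\<^sub>n * \<gamma>\<^sub>p)\<^sup>2 / (81 * L) * (3 * (real j + 1))\<^sup>2"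
    using assms by (intro mult_left_mono power_mono) auto
  also have "\<dots> = weight L \<gamma>\<^sub>n \<gamma>\<^sub>p j * \<gamma>\<^sub>p"
    using assms by (simp add: weight_def field_simps power2_eq_square)
  finally show ?thesis .
qed

text \<open>The case \<open>K = 0\<close>, a single projected gradient step, is stated separately: if
  \<open>L R\<^sup>2 / (\<gamma>\<^sub>n\<^sup>2 \<gamma>\<^sub>p \<epsilon>)\<close> is small, then the query bound is only guaranteed to allow one query.\<close>

lemma accelerated_method_runs:
  assumes L: "0 < L"
  shows "\<exists>x\<in>Q. \<exists>m\<in>Q. \<exists>N\<le>K * (2 * J + 6) + 1. runs Q f g (accelerated_method L \<gamma>\<^sub>n \<gamma>\<^sub>p J K) x N \<and>
    (\<forall>u\<in>Q. f m \<le> f u) \<and> (K = 0 \<longrightarrow> f x - f m \<le> 12 * L * R\<^sup>2) \<and>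
    f x - f m \<le> 36 * L * R\<^sup>2 / (\<gamma>\<^sub>n\<^sup>2 * \<gamma>\<^sub>p * (real K + 1)\<^sup>2) + K * (4 * R * (G + 4 * L * R) / 2 ^ J / \<gamma>\<^sub>n)"
proof -
  define e where "e = 4 * R * (G + 4 * L * R) / 2 ^ J / \<gamma>\<^sub>n"
  define A where "A = weight L \<gamma>\<^sub>n \<gamma>\<^sub>p"
  define \<eta> where "\<eta> = step_size L \<gamma>\<^sub>n \<gamma>\<^sub>p"
  define M :: "nat \<Rightarrow> 'a \<times> 'a \<Rightarrow> ('a \<times> 'a \<Rightarrow> 'a algorithm) \<Rightarrow> 'a algorithm"
    where "M j = accelerated_step (\<eta> j) J (\<eta> j / (\<eta> j + A j / \<gamma>\<^sub>n)) (\<eta> j / (\<eta> j + A j * \<gamma>\<^sub>p))"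
    for j
  obtain m where m: "m \<in> Q" "\<forall>u\<in>Q. f m \<le> f u"
    using ex_minimizer by blast
  define x0 where "x0 = proj 0"
  define y0 where "y0 = proj (x0 - (1 / L) *\<^sub>R g x0)"
  have y0: "y0 \<in> Q" and x0: "x0 \<in> Q"
    by (auto simp: y0_def x0_def proj_in)
  have gap0: "f y0 - f m \<le> 12 * L * R\<^sup>2"
    unfolding y0_def by (rule gradient_step_gap[OF x0 m(1) L])
  have R2: "(norm (y0 - m))\<^sup>2 \<le> 4 * R\<^sup>2"
    using power_mono[OF dist_le[OF y0 m(1)] norm_ge_zero, of 2] by (simp add: power_mult_distrib)
  have "0 \<le> G"
    using lipschitz_fun by (simp add: lipschitz_on_def)
  then have e: "0 \<le> e"
    unfolding e_def using L R_nonneg \<gamma> by simp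
  have A_pos: "0 < A j" for j
    unfolding A_def weight_def using L \<gamma> by simp
  have \<eta>_pos: "0 < \<eta> j" for j
    unfolding \<eta>_def step_size_def using L \<gamma> by (intro mult_pos_pos divide_pos_pos) auto
  have A_Suc: "A j + \<eta> j * \<gamma>\<^sub>n = A (Suc j)" for j
    unfolding A_def \<eta>_def by (rule weight_Suc)
  have A_mono: "A j \<le> A (Suc j)" for j
    using A_Suc[of j] \<eta>_pos[of j] \<gamma> by (smt (verit) mult_pos_pos)
  have step: "(\<eta> j)\<^sup>2 * L \<le> A j * \<gamma>\<^sub>p" for j
    unfolding A_def \<eta>_def by (rule step_size_le[OF L])
  \<comment> \<open>Initially the gap contributes at most \<open>4 / 3 * R\<^sup>2\<close> and the
    distance at most \<open>2 * R\<^sup>2\<close>, together below \<open>4 * R\<^sup>2\<close>. The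
    conjunct on \<open>j = 0\<close> keeps the gradient-step bound for \<open>K = 0\<close>.\<close>
  have iter: "\<exists>x\<in>Q. \<exists>p\<in>Q. \<exists>N\<le>j * (2 * J + 6). computes Q f g (iterate M j (y0, y0)) (x, p) N \<and>
      (j = 0 \<longrightarrow> x = y0) \<and> A j * (f x - f m) + (norm (p - m))\<^sup>2 / 2 \<le> 4 * R\<^sup>2 + j * A j * e" for j
  proof (induction j)
    case 0
    have "\<gamma>\<^sub>n\<^sup>2 * \<gamma>\<^sub>p \<le> 1"
      using \<gamma> by (intro mult_le_one power_le_one) auto
    have "A 0 * (f y0 - f m) \<le> A 0 * (12 * L * R\<^sup>2)"
      using gap0 A_pos[of 0] by (intro mult_left_mono) auto
    also have "\<dots> = \<gamma>\<^sub>n\<^sup>2 * \<gamma>\<^sub>p * (4 / 3 * R\<^sup>2)"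
      using L by (simp add: A_def weight_def)
    also have "\<dots> \<le> 1 * (4 / 3 * R\<^sup>2)"
      by (intro mult_right_mono \<open>\<gamma>\<^sub>n\<^sup>2 * \<gamma>\<^sub>p \<le> 1\<close>) auto
    finally have "A 0 * (f y0 - f m) + (norm (y0 - m))\<^sup>2 / 2 \<le> 4 * R\<^sup>2"
      using R2 zero_le_power2[of R] by linarith
    moreover have "computes Q f g (iterate M 0 (y0, y0)) (y0, y0) 0"
      by (simp add: computes_def)
    ultimately show ?case
      using y0 by (intro bexI[of _ y0] exI[of _ 0]) (auto simp del: iterate.simps)
  next
    case (Suc j)
    then obtain x p N where xp: "x \<in> Q" "p \<in> Q" and N: "N \<le> j * (2 * J + 6)"
      "computes Q f g (iterate M j (y0, y0)) (x, p) N"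
      and pot: "A j * (f x - f m) + (norm (p - m))\<^sup>2 / 2 \<le> 4 * R\<^sup>2 + j * A j * e"
      by blast
    obtain x' p' N' where xp': "x' \<in> Q" "p' \<in> Q" and N': "N' \<le> 2 * J + 6"
      "computes Q f g (M j (x, p)) (x', p') N'"
      and pot': "A (Suc j) * (f x' - f m) + (norm (p' - m))\<^sup>2 / 2 \<le>
        A j * (f x - f m) + (norm (p - m))\<^sup>2 / 2 + A j * e"
      using computes_accelerated_step[OF xp m A_pos[of j] \<eta>_pos[of j] step[of j], of J]
      unfolding M_def A_Suc e_def by blast
    \<comment> \<open>As the weights increase, the errors of all earlier steps may be charged at the
      current weight.\<close>
    have "j * A j * e + A j * e = (real j + 1) * (A j * e)"
      by (simp add: algebra_simps)
    also have "\<dots> \<le> (real j + 1) * (A (Suc j) * e)"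
      using A_mono e by (intro mult_left_mono mult_right_mono) auto
    finally have "j * A j * e + A j * e \<le> real (Suc j) * A (Suc j) * e"
      by (simp add: algebra_simps)
    then have "A (Suc j) * (f x' - f m) + (norm (p' - m))\<^sup>2 / 2 \<le> 4 * R\<^sup>2 + real (Suc j) * A (Suc j) * e"
      using pot pot' by linarith
    moreover have "computes Q f g (iterate M (Suc j) (y0, y0)) (x', p') (N + N')"
      unfolding iterate.simps by (rule computes_bind[where F = "M j", OF N(2) N'(2)])
    ultimately show ?case
      using xp' N(1) N'(1)
      by (intro bexI[of _ x'] bexI[of _ p'] exI[of _ "N + N'"]) (auto simp del: iterate.simps)
  qed
  obtain x p N where x: "x \<in> Q" and N: "N \<le> K * (2 * J + 6)"
    "computes Q f g (iterate M K (y0, y0)) (x, p) N"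
    and zero: "K = 0 \<longrightarrow> x = y0"
    and pot: "A K * (f x - f m) + (norm (p - m))\<^sup>2 / 2 \<le> 4 * R\<^sup>2 + K * A K * e"
    using iter[of K] by blast
  have "A K * (f x - f m) \<le> 4 * R\<^sup>2 + K * A K * e"
    using pot zero_le_power2[of "norm (p - m)"] by linarith
  also have "\<dots> = A K * (4 * R\<^sup>2 / A K + K * e)"
    using A_pos[of K] by (simp add: distrib_left)
  finally have "f x - f m \<le> 4 * R\<^sup>2 / A K + K * e"
    using A_pos[of K] by simp
  also have "4 * R\<^sup>2 / A K = 36 * L * R\<^sup>2 / (\<gamma>\<^sub>n\<^sup>2 * \<gamma>\<^sub>p * (real K + 1)\<^sup>2)"
    by (simp add: A_def weight_def)
  finally have gap: "f x - f m \<le> 36 * L * R\<^sup>2 / (\<gamma>\<^sub>n\<^sup>2 * \<gamma>\<^sub>p * (real K + 1)\<^sup>2) + K * e" .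
  have "runs Q f g (iterate M K (y0, y0) (\<lambda>s. Output (fst s))) x (N + 0)"
    by (rule computesD[OF N(2)]) (simp add: run_output)
  then have "runs Q f g (Project (x0 - (1 / L) *\<^sub>R g x0) (\<lambda>y. iterate M K (y, y) (\<lambda>s. Output (fst s)))) x N"
    by (intro run_project) (simp add: y0_def proj_def)
  then have "runs Q f g (Query x0 (\<lambda>_ u. Project (x0 - (1 / L) *\<^sub>R u)
      (\<lambda>y. iterate M K (y, y) (\<lambda>s. Output (fst s))))) x (Suc N)"
    by (rule run_query[OF x0])
  then have "runs Q f g (accelerated_method L \<gamma>\<^sub>n \<gamma>\<^sub>p J K) x (Suc N)"
    unfolding accelerated_method_def Let_def M_def A_def \<eta>_def
    by (intro run_project) (simp add: x0_def proj_def)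
  then show ?thesis
    using x m N(1) gap gap0 zero unfolding e_def
    by (intro bexI[of _ x] bexI[of _ m] exI[of _ "Suc N"]) auto
qed

end

section \<open>Choice of the parameters\<close>

lemma real_nat_ceiling_le: "0 \<le> x \<Longrightarrow> real (nat \<lceil>x\<rceil>) \<le> x + 1"
  by linarith

text \<open>The exponent 25 is the one needed in \<open>parameter_bounds\<close>. With
  \<open>1 / ln 2 \<le> 3 / 2\<close>, the depth term is at most \<open>75 * ln S\<close>, and the
  additive 8 is at most \<open>12 * ln S\<close>.\<close>

lemma bisection_depth:
  fixes S :: real
  assumes "2 \<le> S"
  shows "S ^ 25 \<le> 2 ^ nat \<lceil>25 * log 2 S\<rceil>" "2 * real (nat \<lceil>25 * log 2 S\<rceil>) + 6 \<le> 87 * ln S"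
    "2 / 3 \<le> ln S"
proof -
  have ln2: "2 / 3 \<le> ln (2 :: real)" by (rule ln2_ge_two_thirds)
  also have le: "ln 2 \<le> ln S" using assms by simp
  finally show ln: "2 / 3 \<le> ln S" .
  have "0 \<le> log 2 S" using assms by simp
  have "S ^ 25 = 2 powr (25 * log 2 S)"
    using assms by (simp add: powr_powr[symmetric] mult.commute[of 25] powr_realpow)
  also have "\<dots> \<le> 2 powr real (nat \<lceil>25 * log 2 S\<rceil>)"
    by (intro powr_mono) (auto simp: real_nat_ceiling_ge)
  also have "\<dots> = 2 ^ nat \<lceil>25 * log 2 S\<rceil>" by (simp add: powr_realpow)
  finally show "S ^ 25 \<le> 2 ^ nat \<lceil>25 * log 2 S\<rceil>" .
  have ceiling: "real (nat \<lceil>25 * log 2 S\<rceil>) \<le> 25 * log 2 S + 1"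
    using \<open>0 \<le> log 2 S\<close> by (intro real_nat_ceiling_le) simp
  have "ln S / ln 2 \<le> ln S / (2 / 3)"
    using ln2 ln by (intro divide_left_mono) auto
  then have "log 2 S \<le> 3 / 2 * ln S"
    by (simp add: log_def)
  then show "2 * real (nat \<lceil>25 * log 2 S\<rceil>) + 6 \<le> 87 * ln S"
    using ceiling ln by linarith
qed

text \<open>The two sources of error, bisection and potential, each get half of
  \<open>\<epsilon>\<close>. All parameters and inverses in play are at most \<open>S\<close>, so a
  power of \<open>S\<close> bounds the required accuracy.\<close>

lemma parameter_bounds:
  fixes L R R\<^sub>g \<gamma>\<^sub>n \<gamma>\<^sub>p \<epsilon> :: real
  assumes "0 < L" "0 < R" "0 \<le> R\<^sub>g" "\<gamma>\<^sub>n \<in> {0<..1}" "\<gamma>\<^sub>p \<in> {0<..1}" "0 < \<epsilon>"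
  defines "S \<equiv> 2 + L + R + R\<^sub>g + 1 / \<gamma>\<^sub>n + 1 / \<gamma>\<^sub>p + 1 / \<epsilon>"
    and "\<kappa> \<equiv> L * R\<^sup>2 / (\<gamma>\<^sub>n\<^sup>2 * \<gamma>\<^sub>p * \<epsilon>)"
  defines "K \<equiv> nat \<lceil>sqrt (72 * \<kappa>)\<rceil>"
  shows "K * (4 * R * (L * (R\<^sub>g + 2 * R) + 4 * L * R) / 2 ^ nat \<lceil>25 * log 2 S\<rceil> / \<gamma>\<^sub>n) \<le> \<epsilon> / 2"
    and "36 * L * R\<^sup>2 / (\<gamma>\<^sub>n\<^sup>2 * \<gamma>\<^sub>p * (real K + 1)\<^sup>2) \<le> \<epsilon> / 2"
    and "1 / 12 \<le> \<kappa> \<Longrightarrow> K * (2 * nat \<lceil>25 * log 2 S\<rceil> + 6) + 1 \<le> 1200 * sqrt \<kappa> * ln S"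
proof -
  have pos: "0 < 1 / \<gamma>\<^sub>n" "0 < 1 / \<gamma>\<^sub>p" "0 < 1 / \<epsilon>" using assms by auto
  have S: "2 \<le> S" "L \<le> S" "R \<le> S" "R\<^sub>g \<le> S" "1 / \<gamma>\<^sub>n \<le> S" "1 / \<gamma>\<^sub>p \<le> S" "1 / \<epsilon> \<le> S"
    unfolding S_def using pos assms(1-3) by linarith+
  have \<kappa>: "0 < \<kappa>" unfolding \<kappa>_def using assms by simp
  have "\<kappa> = L * R\<^sup>2 * ((1 / \<gamma>\<^sub>n)\<^sup>2 * (1 / \<gamma>\<^sub>p) * (1 / \<epsilon>))"
    by (simp add: \<kappa>_def power_divide)
  also have "\<dots> \<le> S * S\<^sup>2 * (S\<^sup>2 * S * S)"
    using S pos assms(1-2) by (intro mult_mono power_mono) auto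
  also have "\<dots> = S ^ 7" by (simp add: eval_nat_numeral)
  finally have \<kappa>_le: "\<kappa> \<le> S ^ 7" .
  have S1: "1 \<le> S ^ 7" using S(1) by (intro one_le_power) auto
  have K_ceiling: "real K \<le> sqrt (72 * \<kappa>) + 1"
    unfolding K_def using \<kappa> by (intro real_nat_ceiling_le) simp
  have "sqrt (72 * \<kappa>) \<le> 72 * \<kappa> + 1"
    using \<kappa> by (intro real_le_lsqrt) (auto simp: power2_eq_square algebra_simps)
  then have K_le: "real K \<le> 74 * S ^ 7"
    using K_ceiling \<kappa>_le S1 by linarith
  have K_ge: "sqrt (72 * \<kappa>) \<le> real K" unfolding K_def by (rule real_nat_ceiling_ge)
  \<comment> \<open>Up to rearrangement, the bisection error is at most
    \<open>\<epsilon> / 2\<close> when this quantity is at most \<open>2 ^ J\<close>. As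
    \<open>4144 \<le> 2 ^ 13 \<le> S ^ 13\<close>, the exponent 12 rises to 25.\<close>
  have "8 * K * (L * R * (R\<^sub>g + 6 * R) * (1 / \<gamma>\<^sub>n) * (1 / \<epsilon>)) \<le>
      8 * (74 * S ^ 7) * (S * S * (S + 6 * S) * S * S)"
    using S pos assms(1-3) K_le by (intro mult_mono add_mono) auto
  also have "\<dots> = 4144 * S ^ 12" by (simp add: eval_nat_numeral)
  also have "\<dots> \<le> S ^ 13 * S ^ 12"
    using power_mono[OF S(1), of 13] S(1) by (intro mult_right_mono) auto
  also have "\<dots> = S ^ 25" by (simp flip: power_add)
  also have "\<dots> \<le> 2 ^ nat \<lceil>25 * log 2 S\<rceil>" by (rule bisection_depth[OF S(1)])
  finally have "8 * K * (L * R * (R\<^sub>g + 6 * R)) / (\<gamma>\<^sub>n * \<epsilon>) \<le> 2 ^ nat \<lceil>25 * log 2 S\<rceil>"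
    by simp
  then have "8 * K * (L * R * (R\<^sub>g + 6 * R)) \<le> 2 ^ nat \<lceil>25 * log 2 S\<rceil> * (\<gamma>\<^sub>n * \<epsilon>)"
    using assms by (simp add: pos_divide_le_eq)
  moreover have "K * (4 * R * (L * (R\<^sub>g + 2 * R) + 4 * L * R) / 2 ^ nat \<lceil>25 * log 2 S\<rceil> / \<gamma>\<^sub>n) =
      4 * K * (L * R * (R\<^sub>g + 6 * R)) / (2 ^ nat \<lceil>25 * log 2 S\<rceil> * \<gamma>\<^sub>n)"
    by (simp add: algebra_simps)
  moreover have "4 * K * (L * R * (R\<^sub>g + 6 * R)) / (2 ^ nat \<lceil>25 * log 2 S\<rceil> * \<gamma>\<^sub>n) \<le> \<epsilon> / 2"
    if "8 * K * (L * R * (R\<^sub>g + 6 * R)) \<le> 2 ^ nat \<lceil>25 * log 2 S\<rceil> * (\<gamma>\<^sub>n * \<epsilon>)"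
    using that assms(4) by (simp add: pos_divide_le_eq mult_ac)
  ultimately show "K * (4 * R * (L * (R\<^sub>g + 2 * R) + 4 * L * R) / 2 ^ nat \<lceil>25 * log 2 S\<rceil> / \<gamma>\<^sub>n) \<le> \<epsilon> / 2"
    by metis
  \<comment> \<open>72 is twice the 36 of the potential bound, to reach
    \<open>\<epsilon> / 2\<close>.\<close>
  have "72 * \<kappa> = (sqrt (72 * \<kappa>))\<^sup>2" using \<kappa> by simp
  also have "\<dots> \<le> (real K + 1)\<^sup>2" using K_ge \<kappa> by (intro power_mono) auto
  finally have "72 * \<kappa> * (\<epsilon> / 2) \<le> (real K + 1)\<^sup>2 * (\<epsilon> / 2)"
    using assms by (intro mult_right_mono) auto
  then have "36 * \<kappa> * \<epsilon> / (real K + 1)\<^sup>2 \<le> \<epsilon> / 2"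
    by (simp add: pos_divide_le_eq mult_ac)
  moreover have "36 * L * R\<^sup>2 / (\<gamma>\<^sub>n\<^sup>2 * \<gamma>\<^sub>p * (real K + 1)\<^sup>2) = 36 * \<kappa> * \<epsilon> / (real K + 1)\<^sup>2"
    using assms(6) by (simp add: \<kappa>_def)
  ultimately show "36 * L * R\<^sup>2 / (\<gamma>\<^sub>n\<^sup>2 * \<gamma>\<^sub>p * (real K + 1)\<^sup>2) \<le> \<epsilon> / 2"
    by simp
  assume \<kappa>': "1 / 12 \<le> \<kappa>"
  \<comment> \<open>A lower bound on \<open>\<kappa>\<close> absorbs additive constants:
    \<open>9 * sqrt \<kappa> + 1 \<le> 13 * sqrt \<kappa>\<close>, and the single extra query is at
    most \<open>6 * sqrt \<kappa> * ln S\<close>. In total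
    \<open>13 * 87 + 6 \<le> 1200\<close>.\<close>
  have "1 / 4 \<le> sqrt \<kappa>"
    using \<kappa>' by (intro real_le_rsqrt) (auto simp: power2_eq_square)
  have "sqrt (72 * \<kappa>) \<le> 9 * sqrt \<kappa>"
    using \<kappa> by (intro real_le_lsqrt) (auto simp: power_mult_distrib)
  then have "real K \<le> 13 * sqrt \<kappa>"
    using K_ceiling \<open>1 / 4 \<le> sqrt \<kappa>\<close> by linarith
  then have "K * (2 * real (nat \<lceil>25 * log 2 S\<rceil>) + 6) \<le> (13 * sqrt \<kappa>) * (87 * ln S)"
    using bisection_depth[OF S(1)] \<kappa> by (intro mult_mono) auto
  moreover have "1 / 4 * (2 / 3) \<le> sqrt \<kappa> * ln S"
    using \<open>1 / 4 \<le> sqrt \<kappa>\<close> bisection_depth(3)[OF S(1)] \<kappa> by (intro mult_mono) auto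
  ultimately show "K * (2 * nat \<lceil>25 * log 2 S\<rceil> + 6) + 1 \<le> 1200 * sqrt \<kappa> * ln S"
    by simp
qed

theorem theorem5:
  shows "\<exists>(C :: real) (k :: nat).
    \<forall>(n :: nat) (L :: real) (\<gamma>\<^sub>n :: real) (\<gamma>\<^sub>p :: real) (R :: real) (R\<^sub>g :: real) (\<epsilon> :: real).
      0 \<le> L \<longrightarrow> \<gamma>\<^sub>n \<in> {0<..1} \<longrightarrow> \<gamma>\<^sub>p \<in> {0<..1} \<longrightarrow> 0 \<le> R \<longrightarrow> 0 \<le> R\<^sub>g \<longrightarrow> 0 < \<epsilon> \<longrightarrow>
      (\<exists>A :: fin_vec algorithm.
        \<forall>(Q :: fin_vec set) (f :: fin_vec \<Rightarrow> real) (g :: fin_vec \<Rightarrow> fin_vec).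
          Q \<subseteq> Rn n \<longrightarrow> Q \<noteq> {} \<longrightarrow> closed Q \<longrightarrow> convex Q \<longrightarrow> bounded Q \<longrightarrow> diameter Q = 2 * R \<longrightarrow>
          g ` Q \<subseteq> Rn n \<longrightarrow>
          tilted_convex_on Q f g \<gamma>\<^sub>n \<gamma>\<^sub>p \<longrightarrow>
          L-lipschitz_on Q g \<longrightarrow>
          (L * (R\<^sub>g + 2 * R))-lipschitz_on Q f \<longrightarrow>
          (\<exists>x N. runs Q f g A x N \<and> eps_minimizer Q f \<epsilon> x \<and>
            int N \<le> \<lceil>C * sqrt (L * R\<^sup>2 / (\<gamma>\<^sub>n\<^sup>2 * \<gamma>\<^sub>p * \<epsilon>)) *
              ln (2 + L + R + R\<^sub>g + 1 / \<gamma>\<^sub>n + 1 / \<gamma>\<^sub>p + 1 / \<epsilon>) ^ k\<rceil>))"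
proof (rule exI[of _ 1200], rule exI[of _ 1], intro allI impI)
  fix n :: nat and L \<gamma>\<^sub>n \<gamma>\<^sub>p R R\<^sub>g \<epsilon> :: real
  assume L: "0 \<le> L" and \<gamma>_unit: "\<gamma>\<^sub>n \<in> {0<..1}" "\<gamma>\<^sub>p \<in> {0<..1}" and R: "0 \<le> R" and R\<^sub>g: "0 \<le> R\<^sub>g" and \<epsilon>: "0 < \<epsilon>"
  define S where "S = 2 + L + R + R\<^sub>g + 1 / \<gamma>\<^sub>n + 1 / \<gamma>\<^sub>p + 1 / \<epsilon>"
  define \<kappa> where "\<kappa> = L * R\<^sup>2 / (\<gamma>\<^sub>n\<^sup>2 * \<gamma>\<^sub>p * \<epsilon>)"
  \<comment> \<open>Below \<open>1 / 12\<close> the initial gradient step is already accurate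
    enough, since \<open>12 * L * R\<^sup>2 \<le> 12 * \<kappa> * \<epsilon>\<close>.\<close>
  define K where "K = (if \<kappa> < 1 / 12 then 0 else nat \<lceil>sqrt (72 * \<kappa>)\<rceil>)"
  define J where "J = nat \<lceil>25 * log 2 S\<rceil>"
  \<comment> \<open>The tree is built from the constants alone, before the instance is given. If
    \<open>L = 0\<close> or \<open>R = 0\<close>, the bound allows no query, but \<open>f\<close> is
    constant on \<open>Q\<close> and any feasible point will do.\<close>
  define A :: "fin_vec algorithm"
    where "A = (if L = 0 \<or> R = 0 then Project 0 Output else accelerated_method L \<gamma>\<^sub>n \<gamma>\<^sub>p J K)"
  have S: "2 \<le> S"
    unfolding S_def using L R R\<^sub>g \<gamma>_unit \<epsilon> by (simp add: add_nonneg_nonneg)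
  have "\<exists>x N. runs Q f g A x N \<and> eps_minimizer Q f \<epsilon> x \<and> int N \<le> \<lceil>1200 * sqrt \<kappa> * ln S ^ 1\<rceil>"
    if Q: "Q \<subseteq> Rn n" "Q \<noteq> {}" "closed Q" "convex Q" "bounded Q" "diameter Q = 2 * R"
      and f: "tilted_convex_on Q f g \<gamma>\<^sub>n \<gamma>\<^sub>p" "L-lipschitz_on Q g" "(L * (R\<^sub>g + 2 * R))-lipschitz_on Q f"
    for Q f g
  proof -
    interpret tilted_convex_problem Q f g L "L * (R\<^sub>g + 2 * R)" R \<gamma>\<^sub>n \<gamma>\<^sub>p
      using Q f compact_Rn_subset[OF Q(1,3,5)] diameter_bounded_bound[OF Q(5)]
      by unfold_locales (auto simp: dist_norm)
    have nonneg: "0 \<le> 1200 * sqrt \<kappa> * ln S"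
      using S L \<gamma> \<epsilon> by (auto simp: \<kappa>_def)
    have minI: "eps_minimizer Q f \<epsilon> x" if "x \<in> Q" "m \<in> Q" "\<forall>u\<in>Q. f m \<le> f u" "f x - f m \<le> \<epsilon>" for x m
      using that by (auto simp: eps_minimizer_def is_arg_min_linorder)
    show ?thesis
    proof (cases "L = 0 \<or> R = 0")
      case True
      obtain m where m: "m \<in> Q" "\<forall>u\<in>Q. f m \<le> f u"
        using ex_minimizer by blast
      have "dist (f (proj 0)) (f m) \<le> (L * (R\<^sub>g + 2 * R)) * dist (proj 0) m"
        by (rule lipschitz_onD[OF f(3) proj_in m(1)])
      also have "\<dots> \<le> 0"
        using True dist_le[OF proj_in m(1)] by (auto simp: dist_norm)
      finally have "eps_minimizer Q f \<epsilon> (proj 0)"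
        using \<epsilon> by (intro minI[OF proj_in m]) simp
      moreover have "runs Q f g A (proj 0) 0"
        using True by (auto simp: A_def proj_def intro!: run_project run_output)
      ultimately show ?thesis
        using nonneg by (intro exI[of _ "proj 0"] exI[of _ 0]) simp
    next
      case False
      then have pos: "0 < L" "0 < R" using L R by auto
      have \<kappa>: "0 < \<kappa>" unfolding \<kappa>_def using pos \<gamma> \<epsilon> by simp
      obtain x m N where x: "x \<in> Q" and m: "m \<in> Q" "\<forall>u\<in>Q. f m \<le> f u" and N: "N \<le> K * (2 * J + 6) + 1"
        and run: "runs Q f g (accelerated_method L \<gamma>\<^sub>n \<gamma>\<^sub>p J K) x N"
        and gap0: "K = 0 \<Longrightarrow> f x - f m \<le> 12 * L * R\<^sup>2"
        and gap: "f x - f m \<le> 36 * L * R\<^sup>2 / (\<gamma>\<^sub>n\<^sup>2 * \<gamma>\<^sub>p * (real K + 1)\<^sup>2) +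
          K * (4 * R * (L * (R\<^sub>g + 2 * R) + 4 * L * R) / 2 ^ J / \<gamma>\<^sub>n)"
        using accelerated_method_runs[OF pos(1), of K J] by blast
      note bounds = parameter_bounds[OF pos R\<^sub>g \<gamma>_unit \<epsilon>, folded S_def \<kappa>_def, folded J_def]
      have "f x - f m \<le> \<epsilon> \<and> int N \<le> \<lceil>1200 * sqrt \<kappa> * ln S\<rceil>"
      proof (cases "\<kappa> < 1 / 12")
        case True
        then have K: "K = 0" by (simp add: K_def)
        have "12 * L * R\<^sup>2 = 12 * \<kappa> * (\<gamma>\<^sub>n\<^sup>2 * \<gamma>\<^sub>p) * \<epsilon>"
          using \<gamma> \<epsilon> by (simp add: \<kappa>_def)
        also have "\<dots> \<le> \<epsilon>"
        proof -
          have "\<gamma>\<^sub>n\<^sup>2 * \<gamma>\<^sub>p \<le> 1"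
            using \<gamma> by (intro mult_le_one power_le_one) auto
          then have "12 * \<kappa> * (\<gamma>\<^sub>n\<^sup>2 * \<gamma>\<^sub>p) \<le> 1"
            using True \<kappa> \<gamma> by (intro mult_le_one[of "12 * \<kappa>"]) auto
          then show ?thesis using \<epsilon> by simp
        qed
        finally have "f x - f m \<le> \<epsilon>" using gap0[OF K] by simp
        \<comment> \<open>The ceiling of a positive number is at least 1, which pays for the one
          query.\<close>
        moreover have "0 < 1200 * sqrt \<kappa> * ln S" using \<kappa> S by simp
        ultimately show ?thesis
          using N K by (simp add: zero_less_ceiling) linarith
      next
        case False
        then have K: "K = nat \<lceil>sqrt (72 * \<kappa>)\<rceil>" by (simp add: K_def)
        have "f x - f m \<le> \<epsilon>"
          using gap bounds(1,2) unfolding K by linarith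
        moreover have "real N \<le> 1200 * sqrt \<kappa> * ln S"
        proof -
          have "real N \<le> real (K * (2 * J + 6) + 1)"
            using N by (rule of_nat_mono)
          also have "\<dots> \<le> 1200 * sqrt \<kappa> * ln S"
            using bounds(3) False unfolding K by simp
          finally show ?thesis .
        qed
        ultimately show ?thesis by linarith
      qed
      then show ?thesis
        using False run minI[OF x m] by (auto simp: A_def)
    qed
  qed
  then show "\<exists>A :: fin_vec algorithm.
        \<forall>(Q :: fin_vec set) (f :: fin_vec \<Rightarrow> real) (g :: fin_vec \<Rightarrow> fin_vec).
          Q \<subseteq> Rn n \<longrightarrow> Q \<noteq> {} \<longrightarrow> closed Q \<longrightarrow> convex Q \<longrightarrow> bounded Q \<longrightarrow> diameter Q = 2 * R \<longrightarrow>
          g ` Q \<subseteq> Rn n \<longrightarrow>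
          tilted_convex_on Q f g \<gamma>\<^sub>n \<gamma>\<^sub>p \<longrightarrow>
          L-lipschitz_on Q g \<longrightarrow>
          (L * (R\<^sub>g + 2 * R))-lipschitz_on Q f \<longrightarrow>
          (\<exists>x N. runs Q f g A x N \<and> eps_minimizer Q f \<epsilon> x \<and>
            int N \<le> \<lceil>1200 * sqrt (L * R\<^sup>2 / (\<gamma>\<^sub>n\<^sup>2 * \<gamma>\<^sub>p * \<epsilon>)) *
              ln (2 + L + R + R\<^sub>g + 1 / \<gamma>\<^sub>n + 1 / \<gamma>\<^sub>p + 1 / \<epsilon>) ^ 1\<rceil>)"
    unfolding S_def \<kappa>_def by blast
qed

end
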